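(* Let $D\subseteq\mathbb{C}$ be a domain, let $k\in\mathbb{N}$ (a positive integer), and let $\mathcal{F}$ be a family of holomorphic functions on $D$ such that all zeros of each $f\in\mathcal{F}$ have multiplicity at least $k$. Let $b\in\mathbb{C}$ with $b\neq 0$, let $A\subset\mathbb{C}$ be a compact set, and let $B=\{z\in\mathbb{C}:|z|\geq\epsilon\}$ for some $\epsilon>0$. Suppose that for each $f\in\mathcal{F}$, $f$ and $f^{(k)}$ partially share the pair $(0,A)$ and $f^{(k)}$ and $f$ partially share the pair $(b,B)$ in $D$; that is, for every $z\in D$: $f(z)=0$ implies $f^{(k)}(z)\in A$, and $f^{(k)}(z)=b$ implies $f(z)\in B$. Then $\mathcal{F}$ is normal in $D$.
   Context: For a set $S\subset\mathbb{C}$ and $\alpha\in\mathbb{C}$, two meromorphic functions $f,g$ on $D$ partially share the pair $(\alpha,S)$ if for every $z\in D$, $f(z)=\alpha$ implies $g(z)\in S$. A family $\mathcal{F}$ of meromorphic (in particular, holomorphic) functions on $D$ is normal in $D$ if every sequence in $\mathcal{F}$ has a subsequence converging locally uniformly in $D$ with respect to the spherical metric; the limit is a meromorphic function on $D$ or identically $\infty$. *)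

theory Defs
  imports "HOL-Complex_Analysis.Complex_Analysis"
begin

text \<open>Points of the Riemann sphere are of type \<^typ>\<open>complex option\<close>, with \<^term>\<open>None\<close> as the
  point at infinity. The chordal distance below is the Euclidean distance of the stereographic
  projections to the unit sphere.\<close>

fun chordal_dist :: "complex option \<Rightarrow> complex option \<Rightarrow> real" where
  "chordal_dist (Some z) (Some w) =
     2 * cmod (z - w) / (sqrt (1 + (cmod z)\<^sup>2) * sqrt (1 + (cmod w)\<^sup>2))"
| "chordal_dist (Some z) None = 2 / sqrt (1 + (cmod z)\<^sup>2)"
| "chordal_dist None (Some w) = 2 / sqrt (1 + (cmod w)\<^sup>2)"
| "chordal_dist None None = 0"

text \<open>A function that is \<^const>\<open>nicely_meromorphic_on\<close> a set takes the dummy value 0 at its poles;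
  its value on the sphere is infinity there. For a function holomorphic on an open set there are
  no poles, so this is just \<^term>\<open>Some (f z)\<close>.\<close>

definition sphere_value :: "(complex \<Rightarrow> complex) \<Rightarrow> complex \<Rightarrow> complex option" where
  "sphere_value f z = (if is_pole f z then None else Some (f z))"

definition spherically_locally_uniform_limit ::
  "complex set \<Rightarrow> (nat \<Rightarrow> complex \<Rightarrow> complex option) \<Rightarrow> (complex \<Rightarrow> complex option) \<Rightarrow> bool" where
  "spherically_locally_uniform_limit D F G \<longleftrightarrow>
     (\<forall>z\<in>D. \<exists>r>0. \<forall>e>0. \<forall>\<^sub>F n in sequentially.
        \<forall>w \<in> ball z r \<inter> D. chordal_dist (F n w) (G w) < e)"

text \<open>The limit need not belong to the family; it is meromorphic or identically infinity.\<close>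

definition normal_family :: "complex set \<Rightarrow> (complex \<Rightarrow> complex) set \<Rightarrow> bool" where
  "normal_family D \<F> \<longleftrightarrow>
     (\<forall>f :: nat \<Rightarrow> complex \<Rightarrow> complex. (\<forall>n. f n \<in> \<F>) \<longrightarrow>
       (\<exists>\<sigma> :: nat \<Rightarrow> nat. \<exists>G. strict_mono \<sigma> \<and>
          ((\<exists>g. g nicely_meromorphic_on D \<and> G = sphere_value g) \<or> G = (\<lambda>_. None)) \<and>
          spherically_locally_uniform_limit D (\<lambda>n. sphere_value (f (\<sigma> n))) G))"

text \<open>Meant for functions without poles in \<open>D\<close> (no special treatment of the value infinity).\<close>

definition partially_share ::
  "complex set \<Rightarrow> (complex \<Rightarrow> complex) \<Rightarrow> (complex \<Rightarrow> complex) \<Rightarrow> complex \<Rightarrow> complex set \<Rightarrow> bool" where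
  "partially_share D f g \<alpha> S \<longleftrightarrow> (\<forall>z\<in>D. f z = \<alpha> \<longrightarrow> g z \<in> S)"

text \<open>A zero near which \<open>f\<close> vanishes identically has infinite multiplicity. It is excluded from the
  condition because \<^term>\<open>zorder f z\<close> is unspecified there.\<close>

definition zeros_multiplicity_ge :: "complex set \<Rightarrow> (complex \<Rightarrow> complex) \<Rightarrow> nat \<Rightarrow> bool" where
  "zeros_multiplicity_ge D f k \<longleftrightarrow>
     (\<forall>z\<in>D. f z = 0 \<longrightarrow> (\<exists>\<^sub>F w in at z. f w \<noteq> 0) \<longrightarrow> zorder f z \<ge> int k)"

end

theory Submission
  imports Defs "HOL-Library.Diagonal_Subsequence"
begin

text \<open>
  The proof rests on a gradient condition that is invariant under rescaling. For
  \<open>g w = f (z + \<rho> * w) / \<rho>^k\<close>, the quantity \<open>\<bar>f'\<bar>^k / \<bar>f\<bar>^(k-1)\<close> does not change; up to constants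
  and a power it is the slope of \<open>\<bar>f\<bar> powr (1/k)\<close>. The hypotheses at the zeros (multiplicity at
  least \<open>k\<close>, and \<open>k\<close>-th derivative in a bounded set) keep this quantity below a
  fixed constant \<open>N\<close> near each zero, see \<open>derivative_small_near_zeros\<close>.

  A bound \<open>\<bar>f'\<bar> \<le> M * L\<close> on a single level set \<open>\<bar>f\<bar> = L\<close> already controls \<open>f\<close> in the large:
  where \<open>\<bar>f\<bar> > L\<close> the function \<open>ln (\<bar>f\<bar> / L)\<close> is positive harmonic, and the argument of
  Hopf's boundary lemma gives \<open>\<bar>f\<bar> \<le> L * exp (2 * M * d)\<close> at distance \<open>d\<close> from a point with
  \<open>\<bar>f\<bar> \<le> L\<close>, see \<open>growth_from_level_gradient\<close>. This replaces the spherical derivative in the usual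
  rescaling argument of Zalcman and Pang, and it gives the exponential type of the limit
  function at the same time.

  Near a point \<open>z0\<close> there are two cases (\<open>local_dichotomy\<close>). If on some low level sets the quantity
  is below \<open>N\<close>, uniformly for the family, then each function is bounded on a small ball
  or bounded away from zero there, with constants common to the family. By Montel's theorem and
  Harnack's inequality, sequences then have subsequences that converge uniformly near \<open>z0\<close>
  to a holomorphic function or to infinity, and \<open>D\<close> being connected, these local limits fit together.
  If not, points where the quantity is at least \<open>N\<close> can be chosen extremally, with values tending to
  zero after comparison with the distance to the boundary. Rescaling there so that the
  modulus becomes \<open>1\<close> produces functions on discs that exhaust the plane, with a locally uniform
  limit \<open>g\<close> along a subsequence (\<open>rescaled_sequence_contradiction\<close>).

  The limit is entire of exponential type and inherits the conditions at the zeros.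
  Where \<open>f^(k) = b\<close> one has \<open>\<bar>f\<bar> \<ge> \<epsilon>\<close>, so the rescaled function is at least \<open>\<epsilon> / \<rho>^k\<close> there, which
  tends to infinity; hence \<open>g^(k)\<close> omits \<open>b\<close> or is constant. Functions \<open>g\<close> of this kind can be listed
  explicitly, and none has a slope at \<open>0\<close> as large as the rescaling provides
  (\<open>entire_limit_contradiction\<close>).
\<close>

section \<open>Harnack's inequality and its boundary form\<close>

text \<open>The Cayley transform of the right half-plane with base point \<open>y\<close> has values in the unit disc.\<close>

lemma cayley_norm_less:
  assumes "Re x > 0" "Re y > 0"
  shows "cmod (x - y) < cmod (x + cnj y)"
proof -
  have "(cmod (x - y))\<^sup>2 < (cmod (x + cnj y))\<^sup>2"
    unfolding cmod_power2 using mult_pos_pos[OF assms]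
    by (simp add: power2_eq_square algebra_simps)
  then show ?thesis
    by (rule power2_less_imp_less) simp
qed

text \<open>Composing \<open>F\<close> with the Cayley transform of the right half-plane based at \<open>F z\<close> gives a self-map
  of the disc that vanishes at the centre, so that the Schwarz lemma applies; the denominator
  of the transform equals \<open>2 * Re (F z)\<close> at the centre.\<close>

lemma positive_real_part_Schwarz:
  assumes holF: "F holomorphic_on ball z R" and "R > 0"
    and pos: "\<And>w. w \<in> ball z R \<Longrightarrow> Re (F w) > 0"
  shows "w \<in> ball z R \<Longrightarrow> cmod (F w - F z) \<le> cmod (w - z) / R * cmod (F w + cnj (F z))"
    and "cmod (deriv F z) \<le> 2 * Re (F z) / R"
proof -
  define p where "p u = (F (z + of_real R * u) - F z) / (F (z + of_real R * u) + cnj (F z))" for u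
  have inb: "z + of_real R * u \<in> ball z R" if "cmod u < 1" for u
    using that \<open>R > 0\<close> by (simp add: dist_norm norm_mult)
  have z: "z \<in> ball z R" using \<open>R > 0\<close> by simp
  have nz: "F v + cnj (F z) \<noteq> 0" if "v \<in> ball z R" for v
    using cayley_norm_less[OF pos[OF that] pos[OF z]] by auto
  have holFR: "(\<lambda>u. F (z + of_real R * u)) holomorphic_on ball 0 1"
    by (rule holomorphic_on_compose_gen[OF _ holF, unfolded o_def])
      (use inb in \<open>auto intro!: holomorphic_intros simp del: mem_ball simp: mem_ball_0\<close>)
  have holp: "p holomorphic_on ball 0 1"
    unfolding p_def using nz inb by (intro holomorphic_intros holFR) auto
  have p0: "p 0 = 0" by (simp add: p_def)
  have pless: "cmod (p u) < 1" if "cmod u < 1" for u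
    using cayley_norm_less[OF pos[OF inb[OF that]] pos[OF z]] nz[OF inb[OF that]]
    by (simp add: p_def norm_divide divide_less_eq)
  show "cmod (F w - F z) \<le> cmod (w - z) / R * cmod (F w + cnj (F z))" if w: "w \<in> ball z R"
  proof -
    define u where "u = (w - z) / of_real R"
    have u: "cmod u < 1" using w \<open>R > 0\<close> by (simp add: u_def norm_divide dist_norm norm_minus_commute)
    have weq: "z + of_real R * u = w" using \<open>R > 0\<close> by (simp add: u_def)
    have "cmod (p u) \<le> cmod u"
      by (rule Schwarz_Lemma(1)[OF holp p0 pless u])
    then show ?thesis using nz[OF w] \<open>R > 0\<close> unfolding p_def weq
      by (simp add: u_def norm_divide divide_le_eq)
  qed
  have d1: "cmod (deriv p 0) \<le> 1"
    using Schwarz_Lemma(2)[OF holp p0, of 0] pless by auto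
  have dF: "(F has_field_derivative deriv F z) (at z)"
    using holomorphic_derivI[OF holF _ z] by simp
  have dF': "(F has_field_derivative deriv F z) (at (z + of_real R * 0))"
    using dF by simp
  have dFR: "((\<lambda>u. F (z + of_real R * u)) has_field_derivative deriv F z * of_real R) (at 0)"
    by (rule DERIV_chain2[where f=F and g="\<lambda>u. z + of_real R * u", OF dF']) (auto intro!: derivative_eq_intros)
  have sum: "F z + cnj (F z) = of_real (2 * Re (F z))"
    by (simp add: complex_add_cnj)
  have "(p has_field_derivative
      ((deriv F z * of_real R - 0) * (F (z + of_real R * 0) + cnj (F z)) -
       (F (z + of_real R * 0) - F z) * (deriv F z * of_real R + 0)) /
      ((F (z + of_real R * 0) + cnj (F z)) * (F (z + of_real R * 0) + cnj (F z)))) (at 0)"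
    unfolding p_def
    by (intro DERIV_divide DERIV_diff DERIV_add dFR DERIV_const) (use nz[OF z] in simp)
  then have "(p has_field_derivative deriv F z * of_real R / of_real (2 * Re (F z))) (at 0)"
    using nz[OF z] by (simp add: sum mult.commute)
  then have "deriv p 0 = deriv F z * of_real R / of_real (2 * Re (F z))"
    by (rule DERIV_imp_deriv)
  then have "cmod (deriv F z) * R / (2 * Re (F z)) \<le> 1"
    using d1 \<open>R > 0\<close> pos[OF z] by (simp add: norm_mult norm_divide)
  then show "cmod (deriv F z) \<le> 2 * Re (F z) / R"
    using \<open>R > 0\<close> pos[OF z] by (simp add: field_simps)
qed

text \<open>Harnack's inequality for the positive harmonic function \<open>Re F\<close>, in a form free of division.
  Squaring the Schwarz estimate and discarding the imaginary parts leaves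
  \<open>a - c \<le> t * (a + c)\<close> for the values \<open>a\<close>, \<open>c\<close> of \<open>Re F\<close> at the two points.\<close>

lemma Harnack_lower_bound:
  assumes holF: "F holomorphic_on ball z R"
    and pos: "\<And>w. w \<in> ball z R \<Longrightarrow> Re (F w) > 0" and w: "w \<in> ball z R"
  shows "Re (F z) * (R - cmod (w - z)) \<le> Re (F w) * (R + cmod (w - z))"
proof -
  have R: "R > 0" using w zero_le_dist[of z w] by (simp del: zero_le_dist)
  define t where "t = cmod (w - z) / R"
  have t: "0 \<le> t" "t < 1" using w R by (auto simp: t_def dist_norm norm_minus_commute)
  define a c y where "a = Re (F z)" and "c = Re (F w)" and "y = Im (F w) - Im (F z)"
  have ac: "a > 0" "c > 0" using pos[OF w] pos[of z] R by (auto simp: a_def c_def)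
  have "cmod (F w - F z) \<le> t * cmod (F w + cnj (F z))"
    using positive_real_part_Schwarz(1)[OF holF R pos w] by (simp add: t_def)
  then have "(cmod (F w - F z))\<^sup>2 \<le> (t * cmod (F w + cnj (F z)))\<^sup>2"
    by (rule power_mono) simp
  then have "(c - a)\<^sup>2 + y\<^sup>2 \<le> t\<^sup>2 * ((c + a)\<^sup>2 + y\<^sup>2)"
    by (simp add: cmod_power2 power_mult_distrib a_def c_def y_def)
  moreover have "t\<^sup>2 * y\<^sup>2 \<le> y\<^sup>2"
    using t by (intro mult_left_le_one_le) (auto simp: power_le_one)
  ultimately have "(c - a)\<^sup>2 \<le> (t * (c + a))\<^sup>2"
    unfolding power_mult_distrib by (simp add: distrib_left add.commute[of a c])
  then have "\<bar>c - a\<bar> \<le> \<bar>t * (c + a)\<bar>"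
    by (simp only: abs_le_square_iff)
  then have "a - c \<le> t * (c + a)"
    using t ac by (simp add: abs_mult)
  then have "R * (a - c) \<le> R * (t * (c + a))"
    using R by simp
  then show ?thesis
    using R by (simp add: a_def c_def t_def algebra_simps)
qed

text \<open>On a ball where \<open>\<bar>f\<bar> > L\<close>, a branch of \<open>log (f / L)\<close> has positive real part. This is how the
  estimates above apply to functions that are large.\<close>

lemma nonvanishing_log_ball:
  assumes holf: "f holomorphic_on ball z R" and L: "L > 0"
    and gt: "\<And>w. w \<in> ball z R \<Longrightarrow> cmod (f w) > L"
  obtains F where "F holomorphic_on ball z R" "\<And>w. w \<in> ball z R \<Longrightarrow> Re (F w) = ln (cmod (f w) / L)"
    "\<And>w. w \<in> ball z R \<Longrightarrow> Re (F w) > 0" "\<And>w. w \<in> ball z R \<Longrightarrow> deriv F w = deriv f w / f w"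
proof -
  have nz: "f w / of_real L \<noteq> 0" if "w \<in> ball z R" for w
    using gt[OF that] L by auto
  obtain F where F: "F holomorphic_on ball z R" "\<And>w. w \<in> ball z R \<Longrightarrow> f w / of_real L = exp (F w)"
  proof (rule contractible_imp_holomorphic_log)
    show "(\<lambda>w. f w / of_real L) holomorphic_on ball z R"
      using holf L by (intro holomorphic_intros) auto
  qed (use nz in \<open>auto simp: convex_imp_contractible\<close>)
  have re: "Re (F w) = ln (cmod (f w) / L)" if "w \<in> ball z R" for w
  proof -
    have "cmod (f w) / L = exp (Re (F w))"
      using arg_cong[OF F(2)[OF that], of cmod] L by (simp add: norm_divide)
    then show ?thesis by simp
  qed
  have "deriv F w = deriv f w / f w" if w: "w \<in> ball z R" for w
  proof -
    have feq: "f v = of_real L * exp (F v)" if "v \<in> ball z R" for v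
      using F(2)[OF that] L by (simp add: field_simps)
    have "(F has_field_derivative deriv F w) (at w)"
      using holomorphic_derivI[OF F(1) _ w] by simp
    then have "((\<lambda>v. of_real L * exp (F v)) has_field_derivative of_real L * (exp (F w) * deriv F w)) (at w)"
      by (auto intro!: derivative_eq_intros)
    then have "(f has_field_derivative of_real L * (exp (F w) * deriv F w)) (at w)"
      by (rule has_field_derivative_transform_within_open[of _ _ _ "ball z R"]) (use w feq in auto)
    then have "deriv f w = f w * deriv F w"
      using feq[OF w] by (simp add: DERIV_imp_deriv)
    then show ?thesis using nz[OF w] by simp
  qed
  moreover have "Re (F w) > 0" if "w \<in> ball z R" for w
    unfolding re[OF that] using gt[OF that] L by (intro ln_gt_zero) (simp add: less_divide_eq)
  ultimately show thesis using that F re by blast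
qed

text \<open>The idea of Hopf's boundary lemma. The positive harmonic function \<open>u = ln (\<bar>f\<bar> / L)\<close> vanishes
  at the boundary point \<open>q\<close>. By Harnack it is at least \<open>s * u z / 2\<close> at relative distance \<open>s\<close> from \<open>q\<close>
  on the radius to \<open>q\<close>, so it decays at most linearly there, and its slope at \<open>q\<close> must be at least
  \<open>u z / (2 * d)\<close>. Read backwards, a small derivative at \<open>q\<close> bounds \<open>f\<close> at the centre.\<close>

lemma Hopf_boundary_gradient:
  assumes holf: "f holomorphic_on U" "open U" "cball z d \<subseteq> U" and L: "L > 0" and d: "d > 0"
    and gt: "\<And>w. w \<in> ball z d \<Longrightarrow> cmod (f w) > L"
    and q: "cmod (q - z) = d" "cmod (f q) = L"
  shows "ln (cmod (f z) / L) \<le> 2 * d * cmod (deriv f q) / L"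
proof -
  have hb: "f holomorphic_on ball z d"
    using holf by (meson ball_subset_cball holomorphic_on_subset subset_trans)
  obtain F where F: "F holomorphic_on ball z d" "\<And>w. w \<in> ball z d \<Longrightarrow> Re (F w) = ln (cmod (f w) / L)"
    "\<And>w. w \<in> ball z d \<Longrightarrow> Re (F w) > 0"
    using nonvanishing_log_ball[OF hb L gt] by metis
  define u where "u = ln (cmod (f z) / L)"
  have zb: "z \<in> ball z d" using d by simp
  have u0: "u > 0" using F(2,3)[OF zb] by (simp add: u_def)
  have "q \<in> U" using q holf by (auto simp: dist_norm norm_minus_commute subset_iff)
  then have df: "(f has_field_derivative deriv f q) (at q)"
    using holf holomorphic_derivI by blast
  define p where "p s = q + of_real s * (z - q)" for s
  have in_ball: "p s \<in> ball z d \<and> cmod (p s - z) = (1 - s) * d" if "0 < s" "s < 1" for s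
  proof -
    have "p s - z = of_real (1 - s) * (q - z)" by (simp add: p_def algebra_simps)
    then have "cmod (p s - z) = (1 - s) * d" using that q by (simp add: norm_mult del: of_real_diff)
    then show ?thesis using that d by (simp add: dist_norm norm_minus_commute)
  qed
  have est: "u / 2 \<le> cmod ((f (p s) - f q) / (of_real s)) / L" if s: "0 < s" "s < 1" for s
  proof -
    have v: "p s \<in> ball z d" "cmod (p s - z) = (1 - s) * d" using in_ball[OF s] by auto
    have "u * (d - (1 - s) * d) \<le> Re (F (p s)) * (d + (1 - s) * d)"
      using Harnack_lower_bound[OF F(1,3) v(1)] F(2)[OF zb] v by (simp add: u_def)
    then have "d * (u * s) \<le> d * (Re (F (p s)) * (2 - s))"
      by (simp add: algebra_simps)
    then have "u * s \<le> Re (F (p s)) * (2 - s)" using d by simp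
    also have "\<dots> \<le> Re (F (p s)) * 2"
      using F(3)[OF v(1)] s by (intro mult_left_mono) auto
    finally have 1: "u * s / 2 \<le> ln (cmod (f (p s)) / L)"
      using F(2)[OF v(1)] by simp
    have "ln (cmod (f (p s)) / L) \<le> cmod (f (p s)) / L - 1"
      using less_trans[OF L gt[OF v(1)]] L by (intro ln_le_minus_one) (simp add: divide_pos_pos)
    also have "\<dots> = (cmod (f (p s)) - cmod (f q)) / L"
      using q L by (simp add: field_simps)
    also have "\<dots> \<le> cmod (f (p s) - f q) / L"
      using L by (intro divide_right_mono norm_triangle_ineq2) auto
    finally have "u * s / 2 \<le> cmod (f (p s) - f q) / L" by (rule order_trans[OF 1])
    then have "u * s / 2 / s \<le> cmod (f (p s) - f q) / L / s" using s by (intro divide_right_mono) auto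
    then show ?thesis using s by (simp add: norm_divide mult.commute)
  qed
  have "z - q \<noteq> 0" using q d by auto
  have lim: "((\<lambda>h. (f (q + h) - f q) / h) \<longlongrightarrow> deriv f q) (at 0)"
    using df by (simp add: DERIV_def)
  have "filterlim (\<lambda>s. of_real s * (z - q)) (at 0) (at_right (0::real))"
    unfolding filterlim_at
  proof
    show "((\<lambda>s. complex_of_real s * (z - q)) \<longlongrightarrow> 0) (at_right 0)"
      by (auto intro!: tendsto_eq_intros)
    show "\<forall>\<^sub>F s in at_right (0::real). complex_of_real s * (z - q) \<in> UNIV \<and> complex_of_real s * (z - q) \<noteq> 0"
      using eventually_at_right_less[of "0::real"] by eventually_elim (use \<open>z - q \<noteq> 0\<close> in auto)
  qed
  from filterlim_compose[OF lim this]
  have "((\<lambda>s. (z - q) * ((f (p s) - f q) / (of_real s * (z - q)))) \<longlongrightarrow> (z - q) * deriv f q) (at_right 0)"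
    unfolding p_def by (intro tendsto_intros)
  then have "((\<lambda>s. (f (p s) - f q) / of_real s) \<longlongrightarrow> (z - q) * deriv f q) (at_right 0)"
    using \<open>z - q \<noteq> 0\<close> by simp
  then have "((\<lambda>s. cmod ((f (p s) - f q) / of_real s) / L) \<longlongrightarrow> cmod ((z - q) * deriv f q) / L) (at_right 0)"
    by (intro tendsto_intros) (use L in auto)
  moreover have "\<forall>\<^sub>F s in at_right (0::real). u / 2 \<le> cmod ((f (p s) - f q) / of_real s) / L"
    using eventually_at_right_real[OF zero_less_one]
    by eventually_elim (use est in auto)
  ultimately have "u / 2 \<le> cmod ((z - q) * deriv f q) / L"
    by (intro tendsto_lowerbound) auto
  also have "cmod ((z - q) * deriv f q) = d * cmod (deriv f q)"
    using q by (simp add: norm_mult norm_minus_commute del: right_diff_distrib left_diff_distrib)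
  finally show ?thesis by (simp add: u_def mult_ac)
qed

section \<open>Growth of holomorphic functions and behaviour at multiple zeros\<close>

text \<open>A bound for the derivative on the level set \<open>\<bar>f\<bar> = L\<close> alone bounds \<open>f\<close> everywhere: take the
  largest ball around \<open>z\<close> on which \<open>\<bar>f\<bar> > L\<close>. It touches the level set at a point \<open>q\<close> no farther
  away than \<open>p\<close>, and Hopf's argument applies there.\<close>

lemma growth_from_level_gradient:
  assumes holf: "f holomorphic_on U" "open U" "cball z (cmod (p - z)) \<subseteq> U" and L: "L > 0" and M: "M \<ge> 0"
    and p: "cmod (f p) \<le> L"
    and grad: "\<And>w. w \<in> cball z (cmod (p - z)) \<Longrightarrow> cmod (f w) = L \<Longrightarrow> cmod (deriv f w) \<le> M * L"
  shows "cmod (f z) \<le> L * exp (2 * M * cmod (p - z))"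
proof (cases "cmod (f z) \<le> L")
  case True
  have "L * 1 \<le> L * exp (2 * M * cmod (p - z))"
    using L M by (intro mult_left_mono) auto
  then show ?thesis using True by simp
next
  case False
  define S where "S = cball z (cmod (p - z)) \<inter> (\<lambda>w. cmod (f w)) -` {..L}"
  have contf: "continuous_on U f" using holf holomorphic_on_imp_continuous_on by blast
  have cont: "continuous_on (cball z (cmod (p - z))) (\<lambda>w. cmod (f w))"
    by (intro continuous_on_norm continuous_on_subset[OF contf] holf(3))
  have "closed S"
    unfolding S_def by (intro continuous_closed_preimage cont) auto
  moreover have pS: "p \<in> S" using p by (simp add: S_def dist_norm norm_minus_commute)
  ultimately obtain q where q: "q \<in> S" "\<And>y. y \<in> S \<Longrightarrow> dist z q \<le> dist z y"
    by (metis distance_attains_inf empty_iff)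
  define d where "d = cmod (q - z)"
  have d: "d > 0" using q False by (auto simp: d_def S_def)
  have dle: "d \<le> cmod (p - z)" using q(2)[OF pS] by (simp add: d_def dist_norm norm_minus_commute)
  have gt: "cmod (f w) > L" if w: "w \<in> ball z d" for w
  proof (rule ccontr)
    assume "\<not> cmod (f w) > L"
    then have "w \<in> S" using w dle by (simp add: S_def)
    from q(2)[OF this] w show False by (simp add: d_def dist_norm norm_minus_commute)
  qed
  have sub: "cball z d \<subseteq> cball z (cmod (p - z))" using dle by auto
  have "cmod (f q) \<ge> L"
  proof (rule continuous_ge_on_closure[where f="\<lambda>w. cmod (f w)" and S="ball z d"])
    show "continuous_on (closure (ball z d)) (\<lambda>w. cmod (f w))"
      using d sub by (auto intro: continuous_on_subset[OF cont])
    show "q \<in> closure (ball z d)" using d by (simp add: d_def dist_norm norm_minus_commute)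
  qed (use gt in \<open>auto simp: less_imp_le\<close>)
  then have fq: "cmod (f q) = L" using q by (simp add: S_def)
  have "ln (cmod (f z) / L) \<le> 2 * d * cmod (deriv f q) / L"
    using Hopf_boundary_gradient[OF holf(1,2) _ L d gt _ fq] sub holf(3) by (auto simp: d_def)
  also have "\<dots> \<le> 2 * d * (M * L) / L"
    using grad[OF _ fq] q d L by (intro divide_right_mono mult_left_mono) (auto simp: S_def)
  also have "\<dots> = 2 * M * d" using L by simp
  also have "\<dots> \<le> 2 * M * cmod (p - z)" using M dle by (intro mult_left_mono) auto
  finally have "exp (ln (cmod (f z) / L)) \<le> exp (2 * M * cmod (p - z))" by simp
  moreover have "cmod (f z) / L > 0" using False L by (intro divide_pos_pos) auto
  ultimately have "cmod (f z) / L \<le> exp (2 * M * cmod (p - z))"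
    by simp
  then show ?thesis using L by (simp add: divide_le_eq mult.commute)
qed

text \<open>Write \<open>f = exp h\<close>. Then \<open>Re h\<close> grows at most linearly, and the derivative estimate for functions
  with positive real part, used on a sufficiently large ball around each point, bounds \<open>h'\<close>.
  By Liouville's theorem \<open>h'\<close> is constant.\<close>

lemma zero_free_exponential_type:
  assumes holf: "f holomorphic_on UNIV" and nz: "\<And>z. f z \<noteq> 0" and C: "C > 0" and T: "T \<ge> 0"
    and growth: "\<And>z. cmod (f z) \<le> C * exp (T * cmod z)"
  obtains a c where "\<And>z. f z = exp (a * z + c)"
proof -
  obtain h where h: "h holomorphic_on UNIV" "\<And>z. f z = exp (h z)"
    using contractible_imp_holomorphic_log[OF holf contractible_UNIV nz] by auto
  have re: "Re (h z) \<le> ln C + T * cmod z" for z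
  proof -
    have "exp (Re (h z)) \<le> exp (ln C + T * cmod z)"
      using growth[of z] C by (simp add: h(2) exp_add)
    then show ?thesis by simp
  qed
  have bd: "cmod (deriv h z) \<le> 2 * (1 + T)" for z
  proof -
    \<comment> \<open>With radius \<open>K\<close> the real part of \<open>F\<close> below is \<open>(1 + T) * K\<close> at the centre, so the bound does not depend on \<open>z\<close>.\<close>
    define K where "K = ln C + T * cmod z + 1 - Re (h z)"
    have K: "K > 0" using re[of z] by (simp add: K_def)
    define F where "F w = of_real (K + T * K + Re (h z)) - h w" for w
    have hol: "F holomorphic_on ball z K"
      unfolding F_def by (intro holomorphic_intros holomorphic_on_subset[OF h(1)]) auto
    have pos: "Re (F w) > 0" if "w \<in> ball z K" for w
    proof -
      have "cmod w \<le> cmod z + K"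
        using that norm_triangle_ineq[of z "w - z"] by (simp add: dist_norm norm_minus_commute)
      then have "T * cmod w \<le> T * cmod z + T * K"
        using mult_left_mono[OF _ T] by (metis distrib_left)
      then show ?thesis using re[of w] K by (simp add: F_def K_def)
    qed
    have "(h has_field_derivative deriv h z) (at z)"
      using holomorphic_derivI[OF h(1)] by simp
    then have "(F has_field_derivative - deriv h z) (at z)"
      unfolding F_def by (auto intro!: derivative_eq_intros)
    then have "cmod (deriv h z) = cmod (deriv F z)"
      by (simp add: DERIV_imp_deriv)
    also have "\<dots> \<le> 2 * Re (F z) / K"
      by (rule positive_real_part_Schwarz(2)[OF hol K pos])
    also have "\<dots> = 2 * (1 + T)"
      using K by (simp add: F_def field_simps)
    finally show ?thesis .
  qed
  have "deriv h constant_on UNIV"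
    using bd by (intro Liouville_theorem holomorphic_deriv h(1)) (auto simp: bounded_iff)
  then obtain a where a: "\<And>z. deriv h z = a" by (auto simp: constant_on_def)
  have "((\<lambda>z. h z - a * z) has_field_derivative 0) (at z)" for z
    using holomorphic_derivI[OF h(1), of z] a[of z] by (auto intro!: derivative_eq_intros)
  then have "\<exists>c. \<forall>z\<in>UNIV. h z - a * z = c"
    by (intro has_field_derivative_zero_constant) auto
  then obtain c where "\<And>z. h z - a * z = c" by auto
  then have "f z = exp (a * z + c)" for z
    using h(2)[of z] by (metis add_diff_cancel_left' add_diff_eq diff_add_cancel)
  then show thesis by (rule that)
qed

text \<open>In the Leibniz formula at \<open>z\<close> only the term survives in which \<open>(w - z) ^ k\<close> is differentiated
  exactly \<open>k\<close> times.\<close>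

lemma higher_deriv_power_factor:
  fixes z :: complex
  assumes G: "G holomorphic_on ball z r" and r: "r > 0"
    and f: "\<And>w. w \<in> ball z r \<Longrightarrow> f w = (w - z) ^ k * G w"
  shows "j < k \<Longrightarrow> (deriv ^^ j) f z = 0" and "(deriv ^^ k) f z = fact k * G z"
proof -
  have eq: "(deriv ^^ j) f z =
    (\<Sum>i = 0..j. of_nat (j choose i) * (pochhammer (of_nat (Suc k - i)) i * 0 ^ (k - i)) * (deriv ^^ (j - i)) G z)" for j
  proof -
    have "(deriv ^^ j) f z = (deriv ^^ j) (\<lambda>w. (w - z) ^ k * G w) z"
      using r f by (intro higher_deriv_cong_ev refl eventually_nhds_in_open[THEN eventually_mono, of "ball z r"]) auto
    also have "\<dots> = (\<Sum>i = 0..j. of_nat (j choose i) * (deriv ^^ i) (\<lambda>w. (w - z) ^ k) z * (deriv ^^ (j - i)) G z)"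
      using r by (intro higher_deriv_mult[of _ "ball z r"] G holomorphic_intros) auto
    finally show ?thesis unfolding higher_deriv_power by simp
  qed
  show "(deriv ^^ j) f z = 0" if "j < k"
    unfolding eq using that by (intro sum.neutral) auto
  have "(deriv ^^ k) f z =
    (\<Sum>i\<in>{k}. of_nat (k choose i) * (pochhammer (of_nat (Suc k - i)) i * 0 ^ (k - i)) * (deriv ^^ (k - i)) G z)"
    unfolding eq by (intro sum.mono_neutral_right) auto
  then show "(deriv ^^ k) f z = fact k * G z"
    by (simp add: pochhammer_fact)
qed

text \<open>The two ways in which the multiplicity hypothesis can hold at a zero: the multiplicity is
  infinite, or it is some finite \<open>m \<ge> k\<close> and splits off.\<close>

lemma multiple_zero_factor:
  assumes holf: "f holomorphic_on D" and D: "open D" and mult: "zeros_multiplicity_ge D f k" and z: "z \<in> D" "f z = 0"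
  obtains (locally_zero) "\<forall>\<^sub>F w in nhds z. f w = 0"
  | (factor) m G r where "m \<ge> k" "m > 0" "r > 0" "ball z r \<subseteq> D" "G holomorphic_on ball z r" "G z \<noteq> 0"
     "\<And>w. w \<in> ball z r \<Longrightarrow> f w = (w - z) ^ m * G w"
proof (cases "\<exists>\<^sub>F w in at z. f w \<noteq> 0")
  case False
  then have "\<forall>\<^sub>F w in at z. f w = 0" by (simp add: frequently_def)
  then have "\<forall>\<^sub>F w in nhds z. f w = 0" using z(2) by (auto simp: eventually_at_filter elim: eventually_mono)
  then show thesis by (rule locally_zero)
next
  case True
  obtain s where s: "s > 0" "ball z s \<subseteq> D" using D z openE by blast
  have "\<exists>w\<in>ball z s. f w \<noteq> 0"
  proof (rule ccontr)
    assume "\<not> ?thesis"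
    moreover have "\<forall>\<^sub>F w in at z. w \<in> ball z s" using s by (intro eventually_at_in_open') auto
    ultimately have "\<forall>\<^sub>F w in at z. f w = 0" by (auto elim: eventually_mono)
    then show False using True by (simp add: frequently_def)
  qed
  from zorder_exist_zero[OF holomorphic_on_subset[OF holf s(2)] _ _ _ this, of z] s z
  obtain r where r: "zorder f z > 0" "r > 0" "cball z r \<subseteq> ball z s" "zor_poly f z holomorphic_on cball z r"
    "\<And>w. w \<in> cball z r \<Longrightarrow> f w = zor_poly f z w * (w - z) ^ nat (zorder f z) \<and> zor_poly f z w \<noteq> 0"
    by auto
  have "zorder f z \<ge> int k" using mult True z by (simp add: zeros_multiplicity_ge_def)
  then show thesis
    using r s by (intro factor[of "nat (zorder f z)" r "zor_poly f z"])
      (auto intro: holomorphic_on_subset simp: subset_iff)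
qed

lemma multiple_zero_higher_deriv:
  assumes "f holomorphic_on D" "open D" "zeros_multiplicity_ge D f k" "z \<in> D" "f z = 0" "j < k"
  shows "(deriv ^^ j) f z = 0"
  using assms(1-5)
proof (cases rule: multiple_zero_factor)
  case locally_zero
  then have "(deriv ^^ j) f z = (deriv ^^ j) (\<lambda>_. 0) z" by (intro higher_deriv_cong_ev) auto
  then show ?thesis by simp
next
  case (factor m G r)
  then show ?thesis using higher_deriv_power_factor(1)[of G z r f m j] assms(6) by auto
qed

text \<open>In terms of \<open>\<phi> = \<bar>f\<bar> powr (1/k)\<close> the inequality says that the slope of \<open>\<phi>\<close> is less than
  \<open>(A + 1) powr (1/k)\<close>. At a zero of order \<open>k\<close> the limit of the slope is the \<open>k\<close>-th root of
  \<open>\<bar>f^(k)(z)\<bar> / k!\<close>, at a zero of higher order it is \<open>0\<close>. So zeros satisfying the hypotheses are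
  surrounded by points of moderate slope. Integer powers keep the statement free of roots.\<close>

lemma derivative_small_near_zeros:
  assumes holf: "f holomorphic_on D" and D: "open D" and mult: "zeros_multiplicity_ge D f k"
    and z: "z \<in> D" "f z = 0" and k: "k > 0" and A: "cmod ((deriv ^^ k) f z) \<le> A"
  shows "\<forall>\<^sub>F w in nhds z. f w \<noteq> 0 \<longrightarrow> cmod (deriv f w) ^ k < real k ^ k * (A + 1) * cmod (f w) ^ (k - 1)"
  using holf D mult z
proof (cases rule: multiple_zero_factor)
  case locally_zero
  then show ?thesis by (rule eventually_mono) auto
next
  case (factor m G r)
  define X where "X w = of_nat m * G w + (w - z) * deriv G w" for w
  define N where "N = real k ^ k * (A + 1)"
  have A0: "A \<ge> 0" using A norm_ge_zero order_trans by blast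
  have N: "N > 0" using k A0 by (simp add: N_def)
  have zb: "z \<in> ball z r" using factor by simp
  have cG: "isCont G z"
    using factor(5) zb holomorphic_on_imp_continuous_on continuous_on_eq_continuous_at open_ball by blast
  have cG': "isCont (deriv G) z"
    using holomorphic_deriv[OF factor(5)] zb holomorphic_on_imp_continuous_on continuous_on_eq_continuous_at open_ball by blast
  have "cmod (z - z) ^ (m - k) * cmod (X z) ^ k < N * cmod (G z) ^ (k - 1)"
  proof (cases "m = k")
    case True
    have "cmod (G z) \<le> fact k * cmod (G z)" by (simp add: mult_le_cancel_right1 fact_ge_1)
    also have "\<dots> \<le> A"
      using A higher_deriv_power_factor(2)[OF factor(5,3,7)] True by (simp add: norm_mult)
    finally have "cmod (G z) < A + 1" by simp
    then have "real k ^ k * cmod (G z) * cmod (G z) ^ (k - 1) < real k ^ k * (A + 1) * cmod (G z) ^ (k - 1)"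
      using factor k by (intro mult_strict_right_mono mult_strict_left_mono) auto
    moreover have "cmod (G z) * cmod (G z) ^ (k - 1) = cmod (G z) ^ k"
      using k by (cases k) auto
    ultimately show ?thesis
      using True by (simp add: X_def N_def norm_mult power_mult_distrib mult.assoc)
  next
    case False
    then have "0 < m - k" using factor by simp
    then show ?thesis using factor N by (simp add: zero_power)
  qed
  moreover have "isCont (\<lambda>w. cmod (w - z) ^ (m - k) * cmod (X w) ^ k) z"
    unfolding X_def by (intro continuous_intros cG cG')
  moreover have "isCont (\<lambda>w. N * cmod (G w) ^ (k - 1)) z"
    by (intro continuous_intros cG)
  ultimately have "isCont (\<lambda>w. N * cmod (G w) ^ (k - 1) - cmod (w - z) ^ (m - k) * cmod (X w) ^ k) z"
    and "0 < N * cmod (G z) ^ (k - 1) - cmod (z - z) ^ (m - k) * cmod (X z) ^ k"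
    by (auto intro: continuous_diff)
  moreover have "\<forall>\<^sub>F w in nhds z. 0 < Y w" if "isCont Y z" "0 < Y z" for Y :: "complex \<Rightarrow> real"
    using that by (auto simp: isCont_def tendsto_at_iff_tendsto_nhds intro: order_tendstoD(1))
  ultimately have "\<forall>\<^sub>F w in nhds z. 0 < N * cmod (G w) ^ (k - 1) - cmod (w - z) ^ (m - k) * cmod (X w) ^ k"
    by blast
  moreover have "\<forall>\<^sub>F w in nhds z. w \<in> ball z r" using factor by (intro eventually_nhds_in_open) auto
  ultimately show ?thesis
  proof eventually_elim
    case (elim w)
    show ?case
    proof
      assume fw: "f w \<noteq> 0"
      then have wz: "w \<noteq> z" using z by auto
      have dG: "(G has_field_derivative deriv G w) (at w)"
        using holomorphic_derivI[OF factor(5) open_ball elim(2)] .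
      have "((\<lambda>v. (v - z) ^ m * G v) has_field_derivative (w - z) ^ (m - 1) * X w) (at w)"
        by (auto intro!: derivative_eq_intros dG) (use factor(2) in \<open>cases m; simp add: X_def algebra_simps\<close>)
      then have "(f has_field_derivative (w - z) ^ (m - 1) * X w) (at w)"
        by (rule has_field_derivative_transform_within_open[of _ _ _ "ball z r"]) (use elim factor in auto)
      then have "deriv f w = (w - z) ^ (m - 1) * X w" by (rule DERIV_imp_deriv)
      then have "cmod (deriv f w) ^ k = cmod (w - z) ^ ((m - 1) * k) * cmod (X w) ^ k"
        by (simp add: norm_mult norm_power power_mult_distrib power_mult)
      \<comment> \<open>The power of \<open>\<bar>w - z\<bar>\<close> on the left exceeds that on the right by \<open>m - k \<ge> 0\<close>.\<close>
      also have "(m - 1) * k = m * (k - 1) + (m - k)"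
        using factor k by (simp add: algebra_simps diff_mult_distrib diff_mult_distrib2)
      also have "cmod (w - z) ^ (m * (k - 1) + (m - k)) * cmod (X w) ^ k =
          cmod (w - z) ^ (m * (k - 1)) * (cmod (w - z) ^ (m - k) * cmod (X w) ^ k)"
        by (simp add: power_add)
      also have "\<dots> < cmod (w - z) ^ (m * (k - 1)) * (N * cmod (G w) ^ (k - 1))"
        using elim wz by (intro mult_strict_left_mono) auto
      also have "\<dots> = N * cmod (f w) ^ (k - 1)"
        using factor(7)[OF elim(2)] by (simp add: norm_mult norm_power power_mult_distrib power_mult)
      finally show "cmod (deriv f w) ^ k < real k ^ k * (A + 1) * cmod (f w) ^ (k - 1)"
        by (simp add: N_def)
    qed
  qed
qed

section \<open>Entire functions of exponential type\<close>

text \<open>All Taylor coefficients beyond the \<open>k\<close>-th vanish.\<close>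

lemma Taylor_polynomial_of_constant_higher_deriv:
  assumes F: "F holomorphic_on UNIV" and c: "\<And>z. (deriv ^^ k) F z = c"
  shows "F z = (\<Sum>i\<le>k. (deriv ^^ i) F p / fact i * (z - p) ^ i)"
proof -
  have 0: "(deriv ^^ i) F p = 0" if "i \<notin> {..k}" for i
  proof -
    define j where "j = i - k"
    have j: "i = j + k" "j > 0" using that by (auto simp: j_def)
    have "(deriv ^^ k) F = (\<lambda>_. c)" using c by auto
    then have "(deriv ^^ i) F p = (deriv ^^ j) (\<lambda>_. c) p" by (simp add: j funpow_add)
    then show ?thesis using j by simp
  qed
  have "(\<lambda>i. (deriv ^^ i) F p / fact i * (z - p) ^ i) sums F z"
    by (rule holomorphic_power_series[where r="cmod (z - p) + 1"])
       (simp_all add: holomorphic_on_subset[OF F] dist_norm norm_minus_commute)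
  moreover have "(\<lambda>i. (deriv ^^ i) F p / fact i * (z - p) ^ i) sums (\<Sum>i\<le>k. (deriv ^^ i) F p / fact i * (z - p) ^ i)"
    using 0 by (intro sums_finite) auto
  ultimately show ?thesis by (rule sums_unique2)
qed

lemma higher_deriv_exp_linear:
  fixes a c :: complex
  shows "(deriv ^^ n) (\<lambda>z. exp (a * z + c)) = (\<lambda>z. a ^ n * exp (a * z + c))"
proof (induction n)
  case (Suc n)
  have "deriv (\<lambda>z. a ^ n * exp (a * z + c)) z = a ^ Suc n * exp (a * z + c)" for z
    by (rule DERIV_imp_deriv) (auto intro!: derivative_eq_intros)
  then show ?case using Suc by auto
qed simp

text \<open>Near infinity \<open>P z * exp (- a * z)\<close> has no zeros. If it also omitted \<open>v \<noteq> 0\<close> there, Picard's great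
  theorem would give it a limit on the sphere at infinity. But it tends to \<open>0\<close> along the ray
  \<open>t / a\<close> and to infinity along the opposite ray.\<close>

lemma polynomial_times_exp_minus_takes_value:
  fixes P :: "complex \<Rightarrow> complex" and c :: "nat \<Rightarrow> complex"
  assumes P: "\<And>z. P z = (\<Sum>i\<le>k. c i * z ^ i)" and k: "k > 0" "c k \<noteq> 0" and a: "a \<noteq> 0" and v: "v \<noteq> 0"
  shows "\<not> (\<forall>\<^sub>F z in at_infinity. P z * exp (- (a * z)) \<noteq> v)"
proof
  define W where "W z = P z * exp (- (a * z))" for z
  assume "\<forall>\<^sub>F z in at_infinity. P z * exp (- (a * z)) \<noteq> v"
  then have "\<forall>\<^sub>F z in at_infinity. W z \<noteq> v" by (simp add: W_def)
  moreover have large: "\<forall>\<^sub>F z in at_infinity. cmod (P z) \<ge> 1"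
    unfolding P using k by (intro polyfun_extremal exI[of _ k]) auto
  ultimately have "\<forall>\<^sub>F z in at_infinity. W z \<noteq> 0 \<and> W z \<noteq> v"
    by eventually_elim (auto simp: W_def)
  then obtain R where R: "\<And>z. cmod z \<ge> R \<Longrightarrow> W z \<noteq> 0 \<and> W z \<noteq> v"
    by (auto simp: eventually_at_infinity)
  define r where "r = 1 / (\<bar>R\<bar> + 1)"
  have r: "r > 0" by (simp add: r_def)
  have far: "cmod (inverse w) \<ge> R" if "w \<in> ball 0 r - {0}" for w
  proof -
    have w: "0 < cmod w" "cmod w < r" using that by auto
    then have "inverse (cmod w) \<ge> inverse r" by (intro le_imp_inverse_le) auto
    then show ?thesis by (simp add: norm_inverse r_def)
  qed
  have holW: "W holomorphic_on UNIV"
    unfolding W_def P by (intro holomorphic_intros)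
  have holWi: "(W \<circ> inverse) holomorphic_on ball 0 r - {0}"
    by (intro holomorphic_on_compose_gen[OF _ holW] holomorphic_intros) auto
  obtain l where l: "((W \<circ> inverse) \<longlongrightarrow> l) (at 0) \<or> ((inverse \<circ> (W \<circ> inverse)) \<longlongrightarrow> l) (at 0)"
    by (rule great_Picard[OF open_ball _ v[symmetric] holWi]) (use r R far in auto)
  have inf: "filterlim (\<lambda>t. of_real t / u) at_infinity (at_top :: real filter)" if "u \<noteq> 0" for u :: complex
    using tendsto_mult_filterlim_at_infinity[OF tendsto_const _ filterlim_of_real_at_infinity, of "inverse u"] that
    by (simp add: field_simps)
  have lim: "filterlim (\<lambda>t. inverse (of_real t / u)) (at 0) (at_top :: real filter)" if "u \<noteq> 0" for u :: complex
    using inf[OF that] by (simp only: filterlim_inverse_at_iff)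
  have plus: "((\<lambda>t::real. W (of_real t / a)) \<longlongrightarrow> 0) at_top"
  proof -
    have "((\<lambda>t. \<Sum>i\<le>k. c i / a ^ i * of_real (t ^ i / exp t)) \<longlongrightarrow> (\<Sum>i\<le>k. c i / a ^ i * of_real 0)) at_top"
      by (intro tendsto_intros tendsto_power_div_exp_0)
    moreover have "(\<Sum>i\<le>k. c i / a ^ i * of_real (t ^ i / exp t)) = W (of_real t / a)" for t :: real
      using a unfolding W_def P sum_distrib_right
      by (intro sum.cong refl) (simp add: power_divide exp_minus divide_simps flip: exp_of_real)
    ultimately show ?thesis by simp
  qed
  have minus: "((\<lambda>t::real. inverse (W (of_real t / (- a)))) \<longlongrightarrow> 0) at_top"
  proof (rule Lim_null_comparison)
    show "((\<lambda>t::real. t ^ 0 / exp t) \<longlongrightarrow> 0) at_top" by (rule tendsto_power_div_exp_0)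
    have "\<forall>\<^sub>F t in (at_top :: real filter). cmod (P (of_real t / (- a))) \<ge> 1"
      using eventually_compose_filterlim[OF large inf[of "- a"]] a by simp
    then show "\<forall>\<^sub>F t in at_top. cmod (inverse (W (of_real t / (- a)))) \<le> t ^ 0 / exp t"
    proof eventually_elim
      case (elim t)
      have "cmod (W (of_real t / (- a))) = cmod (P (of_real t / (- a))) * exp t"
        using a by (simp add: W_def norm_mult)
      moreover have "1 * exp t \<le> cmod (P (of_real t / (- a))) * exp t"
        using elim by (intro mult_right_mono) auto
      ultimately have "exp t \<le> cmod (W (of_real t / (- a)))" by simp
      then have "inverse (cmod (W (of_real t / (- a)))) \<le> inverse (exp t)"
        by (intro le_imp_inverse_le) auto
      then show ?case by (simp add: norm_divide inverse_eq_divide)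
    qed
  qed
  have no: False if u: "u \<noteq> 0" and "((\<lambda>t::real. W (of_real t / u)) \<longlongrightarrow> x) at_top"
    "((\<lambda>t::real. inverse (W (of_real t / u))) \<longlongrightarrow> y) at_top" "x * y = 0" for u x y
  proof -
    have prod: "((\<lambda>t::real. W (of_real t / u) * inverse (W (of_real t / u))) \<longlongrightarrow> 0) at_top"
      using tendsto_mult[OF that(2,3)] that(4) by simp
    have "\<forall>\<^sub>F z in at_infinity. R \<le> cmod z" by (auto simp: eventually_at_infinity)
    from eventually_compose_filterlim[OF this inf[OF u]]
    have "\<forall>\<^sub>F t::real in at_top. W (of_real t / u) * inverse (W (of_real t / u)) = 1"
      by eventually_elim (use R in auto)
    from tendsto_cong[THEN iffD1, OF this prod]
    have "((\<lambda>t::real. 1 :: complex) \<longlongrightarrow> 0) at_top" .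
    then show False by (simp add: tendsto_const_iff)
  qed
  from l show False
  proof
    assume "((W \<circ> inverse) \<longlongrightarrow> l) (at 0)"
    from filterlim_compose[OF this lim[of "- a"]] a
    have "((\<lambda>t::real. W (of_real t / - a)) \<longlongrightarrow> l) at_top" by (simp add: o_def)
    from no[OF _ this minus] a show False by simp
  next
    assume "((inverse \<circ> (W \<circ> inverse)) \<longlongrightarrow> l) (at 0)"
    from filterlim_compose[OF this lim[OF a]]
    have "((\<lambda>t::real. inverse (W (of_real t / a))) \<longlongrightarrow> l) at_top" by (simp add: o_def)
    from no[OF a plus this] show False by simp
  qed
qed


text \<open>The rigidity statement behind the theorem: an entire function of exponential type, with zeros of
  multiplicity at least \<open>k\<close> at which the \<open>k\<close>-th derivative is bounded by \<open>A\<close>, and whose \<open>k\<close>-th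
  derivative is constant or omits \<open>b \<noteq> 0\<close>, cannot have slope as large as prescribed at \<open>0\<close>.

  If \<open>g^(k)\<close> is constant, then \<open>g\<close> is either zero-free, hence an exponential, whose derivatives are
  not constant, or of the form \<open>e * (z - p) ^ k\<close>. The latter has \<open>\<bar>g'\<bar>^k = k^k * \<bar>e\<bar> * \<bar>g\<bar>^(k-1)\<close>
  everywhere, while the condition at the zero \<open>p\<close> gives \<open>\<bar>e\<bar> \<le> A\<close>.
  If \<open>g^(k)\<close> omits \<open>b\<close>, then \<open>g^(k) - b\<close> is an exponential, so \<open>g = P + exp (a * z + d) / a^k\<close>
  with a polynomial \<open>P\<close> of degree \<open>k\<close>. At the zeros of \<open>g\<close> one has \<open>g^(k) = b - a^k * P\<close>, which is
  bounded only if the zeros stay in a bounded set; but by Picard's theorem they do not.\<close>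

lemma entire_limit_contradiction:
  fixes g :: "complex \<Rightarrow> complex" and b :: complex and A C T :: real
  assumes g: "g holomorphic_on UNIV" and C: "C > 0" and T: "T \<ge> 0"
    and growth: "\<And>z. cmod (g z) \<le> C * exp (T * cmod z)"
    and k: "k > 0" and A: "A \<ge> 0" and g0: "cmod (g 0) = 1" and g1: "cmod (deriv g 0) ^ k \<ge> real k ^ k * (A + 1)"
    and zero: "\<And>z j. g z = 0 \<Longrightarrow> j < k \<Longrightarrow> (deriv ^^ j) g z = 0"
    and zero': "\<And>z. g z = 0 \<Longrightarrow> cmod ((deriv ^^ k) g z) \<le> A"
    and b: "b \<noteq> 0" and omit: "(deriv ^^ k) g constant_on UNIV \<or> (\<forall>z. (deriv ^^ k) g z \<noteq> b)"
  shows False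
proof (cases "(deriv ^^ k) g constant_on UNIV")
  case True
  then obtain c where c: "\<And>z. (deriv ^^ k) g z = c" by (auto simp: constant_on_def)
  show False
  proof (cases "\<exists>p. g p = 0")
    case True
    then obtain p where p: "g p = 0" by blast
    define e where "e = c / fact k"
    have geq: "g z = e * (z - p) ^ k" for z
    proof -
      have "g z = (\<Sum>i\<le>k. (deriv ^^ i) g p / fact i * (z - p) ^ i)"
        by (rule Taylor_polynomial_of_constant_higher_deriv[OF g c])
      also have "\<dots> = (\<Sum>i\<in>{k}. (deriv ^^ i) g p / fact i * (z - p) ^ i)"
        using zero[OF p] by (intro sum.mono_neutral_right) auto
      finally show ?thesis by (simp add: c e_def)
    qed
    have "cmod e \<le> cmod c"
      by (simp add: e_def norm_divide divide_le_eq mult_le_cancel_left1 fact_ge_1)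
    also have "\<dots> \<le> A" using zero'[OF p] c by simp
    finally have eA: "cmod e < A + 1" by simp
    have "(g has_field_derivative e * (of_nat k * (0 - p) ^ (k - 1))) (at 0)"
      unfolding geq[abs_def] by (auto intro!: derivative_eq_intros)
    then have "deriv g 0 = e * (of_nat k * (0 - p) ^ (k - 1))" by (rule DERIV_imp_deriv)
    then have "cmod (deriv g 0) ^ k = real k ^ k * (cmod e ^ k * (cmod p ^ (k - 1)) ^ k)"
      by (simp add: norm_mult norm_power power_mult_distrib)
    also have "cmod e ^ k * (cmod p ^ (k - 1)) ^ k = cmod e * (cmod e * cmod p ^ k) ^ (k - 1)"
      using k by (cases k) (auto simp: power_mult_distrib mult.commute simp flip: power_mult)
    also have "cmod e * cmod p ^ k = 1"
      using g0 by (simp add: geq norm_mult norm_power)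
    finally have "cmod (deriv g 0) ^ k = real k ^ k * cmod e" by simp
    also have "\<dots> < real k ^ k * (A + 1)" using eA k by (intro mult_strict_left_mono) auto
    finally show False using g1 by simp
  next
    case False
    then obtain a d where gexp: "\<And>z. g z = exp (a * z + d)"
      using zero_free_exponential_type[OF g _ C T growth] by metis
    have "a \<noteq> 0"
    proof
      assume "a = 0"
      then have "g = (\<lambda>_. exp d)" using gexp by auto
      then have "deriv g 0 = 0" by simp
      moreover have "real k ^ k * (A + 1) > 0" using k A by simp
      ultimately show False using g1 k by (simp add: zero_power)
    qed
    have "g = (\<lambda>z. exp (a * z + d))" using gexp by auto
    then have "a ^ k * exp (a * z + d) = c" for z
      using c[of z] by (simp add: higher_deriv_exp_linear)
    from this[of 0] this[of "1 / a"] \<open>a \<noteq> 0\<close> have "a ^ k * exp (1 + d) = a ^ k * exp d" by simp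
    then have "cmod (exp (1 + d)) = cmod (exp d)" using \<open>a \<noteq> 0\<close> by simp
    then have "exp (1 + Re d) = exp (Re d)" by simp
    then show False by simp
  qed
next
  case False
  with omit have omit: "\<And>z. (deriv ^^ k) g z \<noteq> b" by auto
  define C' where "C' = fact k * C * exp T + cmod b"
  have C': "C' > 0" using C by (simp add: C'_def add_pos_nonneg)
  have gr: "cmod ((deriv ^^ k) g z - b) \<le> C' * exp (T * cmod z)" for z
  proof -
    have "cmod ((deriv ^^ k) g z) \<le> fact k * (C * exp (T * (cmod z + 1))) / 1 ^ k"
    proof (rule Cauchy_inequality)
      show "g holomorphic_on ball z 1" "continuous_on (cball z 1) g"
        using g by (auto intro: holomorphic_on_subset holomorphic_on_imp_continuous_on)
      fix w assume w: "cmod (z - w) = 1"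
      have "cmod w \<le> cmod z + 1" using w norm_triangle_ineq[of z "w - z"] by (simp add: norm_minus_commute)
      then show "cmod (g w) \<le> C * exp (T * (cmod z + 1))"
        using growth[of w] mult_left_mono[OF _ T, of "cmod w" "cmod z + 1"] C
        by (intro order_trans[OF growth[of w]] mult_left_mono) auto
    qed simp
    also have "\<dots> = fact k * C * exp T * exp (T * cmod z)" by (simp add: distrib_left exp_add mult_ac)
    finally have 1: "cmod ((deriv ^^ k) g z) \<le> fact k * C * exp T * exp (T * cmod z)" .
    have "cmod b * 1 \<le> cmod b * exp (T * cmod z)" using T by (intro mult_left_mono) auto
    then show ?thesis using 1 norm_triangle_ineq4[of "(deriv ^^ k) g z" b] by (simp add: C'_def distrib_right)
  qed
  have holk: "(deriv ^^ k) g holomorphic_on UNIV" by (intro holomorphic_higher_deriv g) auto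
  have "(\<lambda>z. (deriv ^^ k) g z - b) holomorphic_on UNIV" by (intro holomorphic_on_diff holk holomorphic_on_const)
  moreover have "(deriv ^^ k) g z - b \<noteq> 0" for z using omit[of z] by simp
  ultimately obtain a d where ad: "\<And>z. (deriv ^^ k) g z - b = exp (a * z + d)"
    using zero_free_exponential_type[OF _ _ C' T gr] by blast
  have "a \<noteq> 0"
  proof
    assume "a = 0"
    then have "(deriv ^^ k) g z = exp d + b" for z using ad[of z] by (simp add: algebra_simps)
    then show False using False by (auto simp: constant_on_def)
  qed
  \<comment> \<open>Subtracting a \<open>k\<close>-fold primitive of the exponential leaves a function with \<open>k\<close>-th derivative \<open>b\<close>.\<close>
  define P where "P z = g z - inverse (a ^ k) * exp (a * z + d)" for z
  have holP: "P holomorphic_on UNIV" unfolding P_def by (intro holomorphic_intros g)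
  have Pk: "(deriv ^^ k) P z = b" for z
  proof -
    have "(deriv ^^ k) P z = (deriv ^^ k) g z - (deriv ^^ k) (\<lambda>z. inverse (a ^ k) * exp (a * z + d)) z"
      unfolding P_def by (rule higher_deriv_diff[OF g]) (auto intro!: holomorphic_intros)
    also have "(deriv ^^ k) (\<lambda>z. inverse (a ^ k) * exp (a * z + d)) z = inverse (a ^ k) * (deriv ^^ k) (\<lambda>z. exp (a * z + d)) z"
      by (rule higher_deriv_cmult[of _ UNIV]) (auto intro!: holomorphic_intros)
    also have "\<dots> = exp (a * z + d)" using \<open>a \<noteq> 0\<close> by (simp add: higher_deriv_exp_linear)
    finally show ?thesis using ad[of z] by (simp add: algebra_simps)
  qed
  define c where "c i = (deriv ^^ i) P 0 / fact i" for i
  have Psum: "P z = (\<Sum>i\<le>k. c i * z ^ i)" for z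
    using Taylor_polynomial_of_constant_higher_deriv[OF holP Pk, of z 0] by (simp add: c_def)
  have ck: "c k \<noteq> 0" using b by (simp add: c_def Pk)
  \<comment> \<open>The value for which \<open>P z * exp (- (a * z)) = v\<close> means \<open>g z = 0\<close>.\<close>
  define v where "v = - exp d / a ^ k"
  have "\<forall>\<^sub>F z in at_infinity. cmod (P z) \<ge> (A + cmod b + 1) / cmod (a ^ k)"
    unfolding Psum using ck k by (intro polyfun_extremal exI[of _ k]) auto
  then have "\<forall>\<^sub>F z in at_infinity. P z * exp (- (a * z)) \<noteq> v"
  proof eventually_elim
    case (elim z)
    show ?case
    proof
      assume "P z * exp (- (a * z)) = v"
      then have "P z * exp (- (a * z)) * exp (a * z) = v * exp (a * z)" by simp
      then have Pz: "P z = v * exp (a * z)" by (simp add: mult.assoc flip: exp_add)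
      then have "g z = 0" by (simp add: P_def v_def exp_add field_simps)
      then have "cmod (exp (a * z + d) + b) \<le> A"
        using zero'[of z] ad[of z] by (simp add: algebra_simps)
      then have "cmod (exp (a * z + d)) \<le> A + cmod b"
        using norm_triangle_ineq4[of "exp (a * z + d) + b" b] by simp
      moreover have "cmod (P z) * cmod (a ^ k) = cmod (exp (a * z + d))"
        using \<open>a \<noteq> 0\<close> unfolding Pz v_def by (simp add: exp_add norm_mult norm_divide)
      ultimately show False using elim \<open>a \<noteq> 0\<close> by (simp add: divide_le_eq)
    qed
  qed
  moreover have "v \<noteq> 0" using \<open>a \<noteq> 0\<close> by (simp add: v_def)
  ultimately show False
    using polynomial_times_exp_minus_takes_value[OF Psum k ck \<open>a \<noteq> 0\<close>] by blast
qed

section \<open>Subsequences and locally uniform limits\<close>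

text \<open>Diagonal selection, for properties that pass to subsequences and do not depend on finitely many
  initial terms.\<close>

lemma diagonal_subsequence:
  fixes Q :: "nat \<Rightarrow> (nat \<Rightarrow> nat) \<Rightarrow> bool"
  assumes ex: "\<And>i s. strict_mono (s :: nat \<Rightarrow> nat) \<Longrightarrow> \<exists>r. strict_mono (r :: nat \<Rightarrow> nat) \<and> Q i (s \<circ> r)"
    and sub: "\<And>i s r. strict_mono (r :: nat \<Rightarrow> nat) \<Longrightarrow> Q i s \<Longrightarrow> Q i (s \<circ> r)"
    and tail: "\<And>i s m. Q i (s \<circ> (+) m) \<Longrightarrow> Q i s"
  obtains s where "strict_mono s" "\<And>i. Q i s"
proof -
  interpret subseqs Q by unfold_locales (rule ex)
  show thesis
  proof
    show "strict_mono diagseq" by (rule subseq_diagseq)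
    show "Q i diagseq" for i by (rule tail[OF diagseq_holds]) (use sub in auto)
  qed
qed

lemma Montel_eventually_bounded:
  fixes F :: "nat \<Rightarrow> complex \<Rightarrow> complex"
  assumes S: "open S" and hol: "\<forall>\<^sub>F n in sequentially. F n holomorphic_on S"
    and bd: "\<forall>\<^sub>F n in sequentially. \<forall>z\<in>S. cmod (F n z) \<le> B"
  obtains r g where "strict_mono (r :: nat \<Rightarrow> nat)" "g holomorphic_on S"
    "\<And>K. compact K \<Longrightarrow> K \<subseteq> S \<Longrightarrow> uniform_limit K (F \<circ> r) g sequentially"
proof -
  obtain N where N: "\<And>n. n \<ge> N \<Longrightarrow> F n holomorphic_on S" "\<And>n z. n \<ge> N \<Longrightarrow> z \<in> S \<Longrightarrow> cmod (F n z) \<le> B"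
    using eventually_conj[OF hol bd] by (auto simp: eventually_sequentially)
  obtain g r where gr: "g holomorphic_on S" "strict_mono r"
    "\<And>K. compact K \<Longrightarrow> K \<subseteq> S \<Longrightarrow> uniform_limit K ((\<lambda>n. F (N + n)) \<circ> r) g sequentially"
  proof (rule Montel[OF S])
    let ?H = "{h. h holomorphic_on S \<and> (\<forall>z\<in>S. cmod (h z) \<le> B)}"
    show "h holomorphic_on S" if "h \<in> ?H" for h using that by simp
    show "\<exists>B. \<forall>h\<in>?H. \<forall>z\<in>K. cmod (h z) \<le> B" if "K \<subseteq> S" for K
      using that by (intro exI[of _ B]) auto
    show "range (\<lambda>n. F (N + n)) \<subseteq> ?H" using N by auto
  qed (erule (1) that, blast)
  show thesis
  proof (rule that)
    show "strict_mono (\<lambda>n. N + r n)" using gr(2) by (simp add: strict_mono_def)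
    show "uniform_limit K (F \<circ> (\<lambda>n. N + r n)) g sequentially" if "compact K" "K \<subseteq> S" for K
      using gr(3)[OF that] by (simp add: o_def)
  qed (rule gr(1))
qed

lemma uniform_limit_compose_subseq:
  assumes "uniform_limit K F g sequentially" "strict_mono (r :: nat \<Rightarrow> nat)"
  shows "uniform_limit K (F \<circ> r) g sequentially"
proof (rule uniform_limitI)
  fix e :: real assume "e > 0"
  from eventually_subseq[OF assms(2) uniform_limitD[OF assms(1) this]]
  show "\<forall>\<^sub>F n in sequentially. \<forall>x\<in>K. dist ((F \<circ> r) n x) (g x) < e" by simp
qed

lemma uniform_limit_tail:
  assumes "uniform_limit K (F \<circ> (+) m) g sequentially"
  shows "uniform_limit K F g sequentially"
proof (rule uniform_limitI)
  fix e :: real assume "e > 0"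
  from uniform_limitD[OF assms this]
  have "\<forall>\<^sub>F n in sequentially. \<forall>x\<in>K. dist (F (n + m) x) (g x) < e" by (simp add: add.commute)
  then show "\<forall>\<^sub>F n in sequentially. \<forall>x\<in>K. dist (F n x) (g x) < e"
    by (rule eventually_sequentially_seg[THEN iffD1])
qed

text \<open>Montel's theorem when each function is defined and bounded on a given disc only from some index
  on, as for rescaled functions.\<close>

lemma Montel_expanding_discs:
  fixes F :: "nat \<Rightarrow> complex \<Rightarrow> complex"
  assumes hol: "\<And>i::nat. \<forall>\<^sub>F n in sequentially. F n holomorphic_on ball 0 (real i)"
    and bd: "\<And>i::nat. \<forall>\<^sub>F n in sequentially. \<forall>z\<in>ball 0 (real i). cmod (F n z) \<le> B i"
  obtains r g where "strict_mono (r :: nat \<Rightarrow> nat)" "g holomorphic_on UNIV"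
    "\<And>K. compact K \<Longrightarrow> uniform_limit K (F \<circ> r) g sequentially"
proof -
  define Q where "Q i s \<longleftrightarrow> (\<exists>g. g holomorphic_on ball 0 (real i) \<and>
    (\<forall>K. compact K \<longrightarrow> K \<subseteq> ball 0 (real i) \<longrightarrow> uniform_limit K (F \<circ> s) g sequentially))" for i and s :: "nat \<Rightarrow> nat"
  obtain s where s: "strict_mono s" "\<And>i. Q i s"
  proof (rule diagonal_subsequence[of Q])
    show "\<exists>r. strict_mono r \<and> Q i (s \<circ> r)" if "strict_mono s" for i and s :: "nat \<Rightarrow> nat"
    proof -
      have "\<forall>\<^sub>F n in sequentially. (F \<circ> s) n holomorphic_on ball 0 (real i)"
        "\<forall>\<^sub>F n in sequentially. \<forall>z\<in>ball 0 (real i). cmod ((F \<circ> s) n z) \<le> B i"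
        using eventually_subseq[OF that hol] eventually_subseq[OF that bd] by (auto simp: o_def)
      from Montel_eventually_bounded[OF open_ball this]
      obtain r g where "strict_mono r" "g holomorphic_on ball 0 (real i)"
        "\<And>K. compact K \<Longrightarrow> K \<subseteq> ball 0 (real i) \<Longrightarrow> uniform_limit K (F \<circ> s \<circ> r) g sequentially" by metis
      then show ?thesis unfolding Q_def o_assoc by blast
    qed
    show "Q i (s \<circ> r)" if "strict_mono r" "Q i s" for i and s r :: "nat \<Rightarrow> nat"
      using that uniform_limit_compose_subseq[where F = "F \<circ> s", OF _ that(1)] unfolding Q_def o_assoc by blast
    show "Q i s" if Q: "Q i (s \<circ> (+) m)" for i and s :: "nat \<Rightarrow> nat" and m
    proof -
      obtain g where g: "g holomorphic_on ball 0 (real i)"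
        "\<And>K. compact K \<Longrightarrow> K \<subseteq> ball 0 (real i) \<Longrightarrow> uniform_limit K (F \<circ> s \<circ> (+) m) g sequentially"
        using Q unfolding Q_def o_assoc by auto
      then show ?thesis unfolding Q_def by (intro exI[of _ g] conjI allI impI uniform_limit_tail[where F = "F \<circ> s"]) simp_all
    qed
  qed (erule that, blast)
  then have "\<forall>i. \<exists>g. g holomorphic_on ball 0 (real i) \<and>
    (\<forall>K. compact K \<longrightarrow> K \<subseteq> ball 0 (real i) \<longrightarrow> uniform_limit K (F \<circ> s) g sequentially)"
    unfolding Q_def by blast
  from choice[OF this] obtain G where G: "\<And>i. G i holomorphic_on ball 0 (real i)"
    "\<And>i K. compact K \<Longrightarrow> K \<subseteq> ball 0 (real i) \<Longrightarrow> uniform_limit K (F \<circ> s) (G i) sequentially"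
    by blast
  define g where "g z = lim (\<lambda>n. F (s n) z)" for z
  have gG: "g z = G i z" if "z \<in> ball 0 (real i)" for i z
  proof -
    have "uniform_limit {z} (F \<circ> s) (G i) sequentially" using that by (intro G) auto
    then have "(\<lambda>n. F (s n) z) \<longlonglongrightarrow> G i z" by (auto simp: o_def uniform_limit_singleton)
    then show ?thesis unfolding g_def by (rule limI)
  qed
  show thesis
  proof (rule that[of s g])
    show "strict_mono s" by (rule s(1))
    show "uniform_limit K (F \<circ> s) g sequentially" if K: "compact K" for K
    proof -
      obtain e where e: "\<And>x. x \<in> K \<Longrightarrow> cmod x \<le> e" using compact_imp_bounded[OF K] by (auto simp: bounded_iff)
      obtain i :: nat where i: "e < real i" using reals_Archimedean2[of e] by blast
      have Ki: "K \<subseteq> ball 0 (real i)" using e i by fastforce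
      have "uniform_limit K (F \<circ> s) (G i) sequentially \<longleftrightarrow> uniform_limit K (F \<circ> s) g sequentially"
        using gG Ki by (intro uniform_limit_cong') (auto simp: subset_iff)
      then show ?thesis using G(2)[OF K Ki] by simp
    qed
    have "g field_differentiable (at z)" for z
    proof -
      obtain i :: nat where i: "cmod z < real i" using reals_Archimedean2[of "cmod z"] by blast
      then have z: "z \<in> ball 0 (real i)" by simp
      have "g holomorphic_on ball 0 (real i)" by (rule holomorphic_transform[OF G(1)[of i]]) (simp add: gG)
      from holomorphic_on_imp_differentiable_at[OF this open_ball z] show ?thesis .
    qed
    then show "g holomorphic_on UNIV" by (simp add: holomorphic_on_def field_differentiable_at_within)
  qed
qed

text \<open>Hurwitz's theorem in positive form: zeros of the limit are inherited by all late terms, since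
  otherwise a zero-free subsequence would have a zero-free limit.\<close>

lemma Hurwitz_eventually_zero:
  assumes S: "open S" "connected S" and hol: "\<forall>\<^sub>F n in sequentially. F n holomorphic_on S" and g: "g holomorphic_on S"
    and ul: "\<And>K. compact K \<Longrightarrow> K \<subseteq> S \<Longrightarrow> uniform_limit K F g sequentially"
    and nonconst: "\<not> g constant_on S" and z: "z \<in> S" "g z = 0"
  shows "\<forall>\<^sub>F n in sequentially. \<exists>w\<in>S. F n w = 0"
proof (rule ccontr)
  assume "\<not> ?thesis"
  then have "\<not> (\<forall>\<^sub>F n in sequentially. F n holomorphic_on S \<longrightarrow> (\<exists>w\<in>S. F n w = 0))"
    by (rule contrapos_nn) (rule eventually_mp[OF _ hol])
  from not_eventually_sequentiallyD[OF this]
  obtain r :: "nat \<Rightarrow> nat" where r: "strict_mono r" "\<And>n. F (r n) holomorphic_on S" "\<And>n w. w \<in> S \<Longrightarrow> F (r n) w \<noteq> 0"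
    by auto
  have "g z \<noteq> 0"
  proof (rule Hurwitz_no_zeros[OF S _ g _ nonconst _ z(1)])
    show "(F \<circ> r) n holomorphic_on S" for n using r(2) by simp
    show "uniform_limit K (F \<circ> r) g sequentially" if "compact K" "K \<subseteq> S" for K
      by (rule uniform_limit_compose_subseq[OF ul[OF that] r(1)])
    show "(F \<circ> r) n w \<noteq> 0" if "w \<in> S" for n w using r(3)[OF that] by simp
  qed
  then show False using z by simp
qed

text \<open>Cauchy's estimate for \<open>F n - g\<close> on balls of radius \<open>r / 2\<close> around the points of the smaller ball.\<close>

lemma higher_deriv_uniform_limit:
  assumes hol: "\<forall>\<^sub>F n in sequentially. F n holomorphic_on ball z R" and g: "g holomorphic_on ball z R"
    and ul: "uniform_limit (cball z r) F g sequentially" and r: "0 < r" "r < R"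
  shows "uniform_limit (cball z (r / 2)) (\<lambda>n. (deriv ^^ j) (F n)) ((deriv ^^ j) g) sequentially"
proof (rule uniform_limitI)
  fix e :: real assume e: "e > 0"
  define e' where "e' = e * (r / 2) ^ j / (2 * fact j)"
  have e': "e' > 0" using e r by (simp add: e'_def)
  show "\<forall>\<^sub>F n in sequentially. \<forall>w\<in>cball z (r / 2). dist ((deriv ^^ j) (F n) w) ((deriv ^^ j) g w) < e"
    using hol uniform_limitD[OF ul e']
  proof eventually_elim
    case (elim n)
    show ?case
    proof
      fix w assume w: "w \<in> cball z (r / 2)"
      have sub: "cball w (r / 2) \<subseteq> cball z r"
        using w by (auto simp: cball_subset_cball_iff dist_commute)
      have sub': "cball w (r / 2) \<subseteq> ball z R" using sub r by auto
      have hF: "F n holomorphic_on ball z R" by (rule elim(1))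
      have hd: "(\<lambda>w. F n w - g w) holomorphic_on ball z R" by (intro holomorphic_intros hF g)
      have "cmod ((deriv ^^ j) (\<lambda>w. F n w - g w) w) \<le> fact j * e' / (r / 2) ^ j"
      proof (rule Cauchy_inequality)
        show "(\<lambda>w. F n w - g w) holomorphic_on ball w (r / 2)"
          using sub' ball_subset_cball by (intro holomorphic_on_subset[OF hd]) blast
        show "continuous_on (cball w (r / 2)) (\<lambda>w. F n w - g w)"
          using sub' by (intro holomorphic_on_imp_continuous_on holomorphic_on_subset[OF hd])
        show "cmod (F n x - g x) \<le> e'" if "cmod (w - x) = r / 2" for x
        proof -
          have "x \<in> cball z r" using that sub by (auto simp: dist_norm subset_iff)
          then show ?thesis using elim(2) by (auto simp: dist_norm less_imp_le)
        qed
      qed (use r in auto)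
      also have "\<dots> = e / 2" using r by (simp add: e'_def)
      also have "\<dots> < e" using e by simp
      also have "(deriv ^^ j) (\<lambda>w. F n w - g w) w = (deriv ^^ j) (F n) w - (deriv ^^ j) g w"
        using subsetD[OF sub', of w] r by (intro higher_deriv_diff[OF hF g]) auto
      finally show "dist ((deriv ^^ j) (F n) w) ((deriv ^^ j) g w) < e" by (simp add: dist_norm)
    qed
  qed
qed

text \<open>Used to carry pointwise conditions at zeros to the limit: the zeros of the terms are not at
  \<open>z\<close>, only arbitrarily close to it.\<close>

lemma uniform_limit_value_in_closed:
  fixes H :: "nat \<Rightarrow> 'a::metric_space \<Rightarrow> 'b::metric_space"
  assumes ul: "uniform_limit (cball z r) H h sequentially" and r: "r > 0" and cont: "isCont h z" and T: "closed T"
    and near: "\<And>e. e > 0 \<Longrightarrow> \<forall>\<^sub>F n in sequentially. \<exists>w\<in>ball z e. H n w \<in> T"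
  shows "h z \<in> T"
proof (rule ccontr)
  assume "h z \<notin> T"
  then obtain e where e: "e > 0" "ball (h z) e \<subseteq> - T" using T open_contains_ball[of "- T"] by auto
  obtain d where d: "d > 0" "\<And>w. dist w z < d \<Longrightarrow> dist (h w) (h z) < e / 2"
    using cont e by (metis continuous_at_eps_delta half_gt_zero)
  have dr: "min d r > 0" and e2: "e / 2 > 0" using d r e by auto
  have "\<forall>\<^sub>F n in sequentially. False"
    using near[OF dr] uniform_limitD[OF ul e2]
  proof eventually_elim
    case (elim n)
    then obtain w where w: "w \<in> ball z (min d r)" "H n w \<in> T" by blast
    have "dist (H n w) (h w) < e / 2" using elim w by auto
    moreover have "dist (h w) (h z) < e / 2" using w d by (auto simp: dist_commute)
    ultimately have "H n w \<in> ball (h z) e"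
      using dist_triangle[of "h z" "H n w" "h w"] by (simp add: dist_commute)
    then show False using e w by auto
  qed
  then show False by simp
qed

lemma entire_constant_on_ball:
  assumes f: "f holomorphic_on UNIV" and c: "f constant_on ball z e" and e: "e > 0"
  shows "f constant_on UNIV"
proof -
  obtain c where c: "\<And>w. w \<in> ball z e \<Longrightarrow> f w = c" using c by (auto simp: constant_on_def)
  have "f w - c = 0" for w
  proof (rule analytic_continuation[of "\<lambda>w. f w - c" UNIV "ball z e" z])
    show "(\<lambda>w. f w - c) holomorphic_on UNIV" by (intro holomorphic_intros f)
    show "z islimpt ball z e" using e by (simp add: islimpt_ball)
  qed (use c in auto)
  then show ?thesis by (auto simp: constant_on_def)
qed

section \<open>Sequences on expanding discs\<close>

text \<open>Otherwise \<open>ln (2 * \<bar>g\<bar>)\<close> would be positive harmonic in the disc of radius \<open>2\<close> with value \<open>ln 2\<close>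
  at the centre, and its gradient there would be at most \<open>ln 2 < 1\<close>.\<close>

lemma small_value_from_large_gradient:
  assumes g: "g holomorphic_on ball 0 2" and g0: "cmod (g 0) = 1" and g1: "cmod (deriv g 0) \<ge> 1"
  obtains p where "p \<in> ball 0 2" "cmod (g p) \<le> 1 / 2"
proof (rule ccontr)
  note found = that
  assume no: "\<not> thesis"
  have gt: "cmod (g w) > 1 / 2" if "w \<in> ball 0 2" for w
    using no found[OF that] by linarith
  obtain F where F: "F holomorphic_on ball 0 2" "\<And>w. w \<in> ball 0 2 \<Longrightarrow> Re (F w) = ln (cmod (g w) / (1 / 2))"
    "\<And>w. w \<in> ball 0 2 \<Longrightarrow> Re (F w) > 0" "\<And>w. w \<in> ball 0 2 \<Longrightarrow> deriv F w = deriv g w / g w"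
    using nonvanishing_log_ball[OF g _ gt] by auto
  have "1 \<le> cmod (deriv F 0)" using g0 g1 by (simp add: F(4) norm_divide)
  also have "\<dots> \<le> 2 * Re (F 0) / 2"
    by (rule positive_real_part_Schwarz(2)[OF F(1) _ F(3)]) auto
  also have "\<dots> = ln 2" using g0 by (simp add: F(2))
  also have "\<dots> < 1" using ln_2_less_1 .
  finally show False by simp
qed

text \<open>The bound on the level set \<open>\<bar>G n\<bar> = 1/2\<close>, together with the presence of a point with
  \<open>\<bar>G n\<bar> \<le> 1/2\<close> near \<open>0\<close>, yields locally uniform bounds of exponential type. A limit function
  is therefore entire of exponential type. By Hurwitz's theorem it inherits the conditions
  at the zeros. If its \<open>k\<close>-th derivative took the value \<open>b\<close> without being constant, then so would
  those of the \<open>G n\<close> nearby, and \<open>\<bar>G n\<bar> \<ge> E n\<close> would contradict boundedness. Such a limit has been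
  excluded.\<close>

lemma rescaled_sequence_contradiction:
  fixes G :: "nat \<Rightarrow> complex \<Rightarrow> complex" and R E :: "nat \<Rightarrow> real" and b :: complex and A :: real
  assumes R: "filterlim R at_top sequentially" and E: "filterlim E at_top sequentially"
    and k: "k > 0" and A: "A \<ge> 0" and b: "b \<noteq> 0"
    and hol: "\<And>n. G n holomorphic_on ball 0 (R n)"
    and zero: "\<And>n z j. z \<in> ball 0 (R n) \<Longrightarrow> G n z = 0 \<Longrightarrow> j < k \<Longrightarrow> (deriv ^^ j) (G n) z = 0"
    and zero': "\<And>n z. z \<in> ball 0 (R n) \<Longrightarrow> G n z = 0 \<Longrightarrow> cmod ((deriv ^^ k) (G n) z) \<le> A"
    and share: "\<And>n z. z \<in> ball 0 (R n) \<Longrightarrow> (deriv ^^ k) (G n) z = b \<Longrightarrow> cmod (G n z) \<ge> E n"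
    and G0: "\<And>n. cmod (G n 0) = 1" and G1: "\<And>n. cmod (deriv (G n) 0) ^ k \<ge> real k ^ k * (A + 1)"
    and level: "\<And>K. \<forall>\<^sub>F n in sequentially. \<forall>w\<in>ball 0 K. cmod (G n w) = 1 / 2 \<longrightarrow>
      cmod (deriv (G n) w) ^ k \<le> real k ^ k * (A + 1)"
  shows False
proof -
  define N where "N = real k ^ k * (A + 1)"
  have "1 \<le> real k ^ k" using k by (intro one_le_power) auto
  then have "1 * 1 \<le> N" unfolding N_def using A by (intro mult_mono) auto
  then have N: "N \<ge> 1" by simp
  have dom: "\<forall>\<^sub>F n in sequentially. K < R n" for K
    using R by (simp add: filterlim_at_top_dense)
  have large: "cmod (deriv (G n) 0) \<ge> 1" for n
    using G1[of n] N k power_less_one_iff[of "cmod (deriv (G n) 0)" k] unfolding N_def[symmetric] by fastforce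
  have growth: "\<forall>\<^sub>F n in sequentially. \<forall>z\<in>ball 0 (real i). cmod (G n z) \<le> 1 / 2 * exp (4 * N * (cmod z + 2))" for i
    using dom[of "2 * real i + 2"] level[of "2 * real i + 2"]
  proof eventually_elim
    case (elim n)
    show ?case
    proof
      fix z :: complex assume z: "z \<in> ball 0 (real i)"
      have "i > 0" using z norm_ge_zero[of z] by (cases i) auto
      then have "ball 0 2 \<subseteq> ball 0 (R n)" using elim(1) by (intro subset_ball) simp
      then have "G n holomorphic_on ball 0 2" by (rule holomorphic_on_subset[OF hol])
      then obtain p where p: "p \<in> ball 0 2" "cmod (G n p) \<le> 1 / 2"
        using small_value_from_large_gradient[OF _ G0 large] by blast
      have pz: "cmod (p - z) \<le> 2 + cmod z" using p norm_triangle_ineq4[of p z] by simp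
      have sub: "w \<in> ball 0 (2 * real i + 2)" if "w \<in> cball z (cmod (p - z))" for w
        using that pz z norm_triangle_ineq[of z "w - z"] by (simp add: dist_norm norm_minus_commute)
      have "cmod (G n z) \<le> 1 / 2 * exp (2 * (2 * N) * cmod (p - z))"
      proof (rule growth_from_level_gradient[OF hol open_ball])
        show "cball z (cmod (p - z)) \<subseteq> ball 0 (R n)" using sub elim(1) by fastforce
        show "cmod (deriv (G n) w) \<le> 2 * N * (1 / 2)"
          if "w \<in> cball z (cmod (p - z))" "cmod (G n w) = 1 / 2" for w
        proof (rule ccontr)
          assume "\<not> ?thesis"
          then have gtN: "cmod (deriv (G n) w) > N" by simp
          then have "cmod (deriv (G n) w) \<le> cmod (deriv (G n) w) ^ k" using N k by (intro self_le_power) auto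
          moreover have "cmod (deriv (G n) w) ^ k \<le> N" using elim(2) sub[OF that(1)] that(2) by (simp add: N_def)
          ultimately show False using gtN by simp
        qed
      qed (use N p in auto)
      also have "\<dots> \<le> 1 / 2 * exp (4 * N * (cmod z + 2))"
        using pz N by (simp add: add.commute)
      finally show "cmod (G n z) \<le> 1 / 2 * exp (4 * N * (cmod z + 2))" .
    qed
  qed
  obtain r g where r: "strict_mono (r :: nat \<Rightarrow> nat)" and g: "g holomorphic_on UNIV"
    and ul: "\<And>K. compact K \<Longrightarrow> uniform_limit K (G \<circ> r) g sequentially"
  proof (rule Montel_expanding_discs[of G "\<lambda>i. 1 / 2 * exp (4 * N * (real i + 2))"])
    show "\<forall>\<^sub>F n in sequentially. G n holomorphic_on ball 0 (real i)" for i
      using dom[of "real i"] by eventually_elim (rule holomorphic_on_subset[OF hol], auto)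
    show "\<forall>\<^sub>F n in sequentially. \<forall>z\<in>ball 0 (real i). cmod (G n z) \<le> 1 / 2 * exp (4 * N * (real i + 2))" for i
      using growth[of i]
    proof eventually_elim
      case (elim n)
      show ?case
      proof
        fix z :: complex assume z: "z \<in> ball 0 (real i)"
        then have "4 * N * (cmod z + 2) \<le> 4 * N * (real i + 2)" using N by (intro mult_left_mono) auto
        then have "1 / 2 * exp (4 * N * (cmod z + 2)) \<le> 1 / 2 * exp (4 * N * (real i + 2))" by simp
        then show "cmod (G n z) \<le> 1 / 2 * exp (4 * N * (real i + 2))" using bspec[OF elim z] by (rule order_trans[rotated])
      qed
    qed
  qed (erule (1) that, blast)
  define H where "H = G \<circ> r"
  note ulH = ul[folded H_def]
  have domH: "\<forall>\<^sub>F n in sequentially. K < R (r n)" for K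
    by (rule eventually_subseq[OF r dom])
  have holH: "\<forall>\<^sub>F n in sequentially. H n holomorphic_on ball z s" for z s
    using domH[of "cmod z + s"]
  proof eventually_elim
    case (elim n)
    have "ball z s \<subseteq> ball 0 (R (r n))"
      using elim norm_triangle_ineq by (auto simp: ball_subset_ball_iff)
    then show ?case unfolding H_def o_def by (rule holomorphic_on_subset[OF hol])
  qed
  have gb: "g holomorphic_on ball z s" for z s by (rule holomorphic_on_subset[OF g]) simp
  have derivH: "uniform_limit (cball z s) (\<lambda>n. (deriv ^^ j) (H n)) ((deriv ^^ j) g) sequentially" if "s > 0" for z s j
    using higher_deriv_uniform_limit[OF holH gb, of z "2 * s" "3 * s" j] ulH[OF compact_cball] that
    by simp
  have pointwise: "(\<lambda>n. (deriv ^^ j) (H n) z) \<longlonglongrightarrow> (deriv ^^ j) g z" for j z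
    by (rule tendsto_uniform_limitI[OF derivH[OF zero_less_one, where z = z]]) auto
  have g0: "cmod (g 0) = 1"
    using tendsto_norm[OF pointwise[of 0 0]] G0 by (simp add: H_def LIMSEQ_const_iff)
  have g1: "cmod (deriv g 0) ^ k \<ge> real k ^ k * (A + 1)"
    using tendsto_power[OF tendsto_norm[OF pointwise[of 1 0]], of k] G1
    by (intro LIMSEQ_le_const) (auto simp: H_def)
  have ggrowth: "cmod (g z) \<le> (1 / 2 * exp (8 * N)) * exp (4 * N * cmod z)" for z
  proof -
    obtain i :: nat where i: "cmod z < real i" using reals_Archimedean2[of "cmod z"] by blast
    have ev: "\<forall>\<^sub>F n in sequentially. cmod (H n z) \<le> 1 / 2 * exp (4 * N * (cmod z + 2))"
      using eventually_subseq[OF r growth[of i]] by eventually_elim (use i in \<open>auto simp: H_def\<close>)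
    have "(\<lambda>n. cmod (H n z)) \<longlonglongrightarrow> cmod (g z)"
      using tendsto_norm[OF pointwise[of 0 z]] by simp
    then have "cmod (g z) \<le> 1 / 2 * exp (4 * N * (cmod z + 2))"
      by (rule tendsto_upperbound[OF _ ev]) simp
    then show ?thesis by (simp add: exp_add distrib_left mult_ac)
  qed
  have "\<not> g constant_on UNIV"
  proof
    assume "g constant_on UNIV"
    then obtain c where "\<And>z. g z = c" by (auto simp: constant_on_def)
    then have "g = (\<lambda>_. c)" by auto
    then have "deriv g 0 = 0" by simp
    then show False using g1 N k by (simp add: N_def zero_power)
  qed
  then have nonconst: "\<not> g constant_on ball z s" if "s > 0" for z s
    using entire_constant_on_ball[OF g _ that] by blast
  have near_zero: "\<forall>\<^sub>F n in sequentially. \<exists>w\<in>ball z e. H n w = 0 \<and> w \<in> ball 0 (R (r n))"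
    if z: "g z = 0" and e: "e > 0" for z e
  proof -
    have "\<forall>\<^sub>F n in sequentially. \<exists>w\<in>ball z e. H n w = 0"
      by (rule Hurwitz_eventually_zero[OF open_ball connected_ball holH gb ulH nonconst[OF e] _ z])
        (use e in auto)
    then show ?thesis using domH[of "cmod z + e"]
    proof eventually_elim
      case (elim n)
      then obtain w where w: "w \<in> ball z e" "H n w = 0" by blast
      have "w \<in> ball 0 (R (r n))"
        using w elim norm_triangle_ineq[of z "w - z"] by (simp add: dist_norm norm_minus_commute)
      then show ?case using w by blast
    qed
  qed
  have holg: "(deriv ^^ j) g holomorphic_on UNIV" for j by (intro holomorphic_higher_deriv g) auto
  have cont: "isCont ((deriv ^^ j) g) z" for j z
    using holomorphic_on_imp_continuous_on[OF holg[of j]] by (simp add: continuous_on_eq_continuous_at)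
  have z1: "(deriv ^^ j) g z = 0" if z: "g z = 0" and j: "j < k" for z j
  proof -
    have "(deriv ^^ j) g z \<in> {0}"
    proof (rule uniform_limit_value_in_closed[OF derivH[OF zero_less_one] zero_less_one cont])
      fix e :: real assume "e > 0"
      from near_zero[OF z this]
      show "\<forall>\<^sub>F n in sequentially. \<exists>w\<in>ball z e. (deriv ^^ j) (H n) w \<in> {0}"
        by eventually_elim (use zero j in \<open>auto simp: H_def\<close>)
    qed simp
    then show ?thesis by simp
  qed
  have z2: "cmod ((deriv ^^ k) g z) \<le> A" if z: "g z = 0" for z
  proof -
    have "(deriv ^^ k) g z \<in> cball 0 A"
    proof (rule uniform_limit_value_in_closed[OF derivH[OF zero_less_one] zero_less_one cont])
      fix e :: real assume "e > 0"
      from near_zero[OF z this]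
      show "\<forall>\<^sub>F n in sequentially. \<exists>w\<in>ball z e. (deriv ^^ k) (H n) w \<in> cball 0 A"
        by eventually_elim (use zero' in \<open>fastforce simp: H_def\<close>)
    qed simp
    then show ?thesis by simp
  qed
  have omit: "(deriv ^^ k) g constant_on UNIV \<or> (\<forall>z. (deriv ^^ k) g z \<noteq> b)"
  proof (rule ccontr)
    assume "\<not> ?thesis"
    then obtain z where nc: "\<not> (deriv ^^ k) g constant_on UNIV" and z: "(deriv ^^ k) g z = b" by blast
    have ev: "\<forall>\<^sub>F n in sequentially. \<exists>w\<in>ball z 1. (deriv ^^ k) (H n) w - b = 0"
    proof (rule Hurwitz_eventually_zero[where g = "\<lambda>w. (deriv ^^ k) g w - b" and z = z])
      show "\<forall>\<^sub>F n in sequentially. (\<lambda>w. (deriv ^^ k) (H n) w - b) holomorphic_on ball z 1"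
        using holH[of z 1] by eventually_elim (intro holomorphic_intros, auto)
      show "(\<lambda>w. (deriv ^^ k) g w - b) holomorphic_on ball z 1"
        by (intro holomorphic_intros holomorphic_on_subset[OF holg]) auto
      show "uniform_limit K (\<lambda>n w. (deriv ^^ k) (H n) w - b) (\<lambda>w. (deriv ^^ k) g w - b) sequentially"
        if "compact K" "K \<subseteq> ball z 1" for K
        using that ball_subset_cball
        by (intro uniform_limit_intros uniform_limit_on_subset[OF derivH[OF zero_less_one, where z = z]]) blast
      show "\<not> (\<lambda>w. (deriv ^^ k) g w - b) constant_on ball z 1"
      proof
        assume "(\<lambda>w. (deriv ^^ k) g w - b) constant_on ball z 1"
        then obtain c where "\<And>w. w \<in> ball z 1 \<Longrightarrow> (deriv ^^ k) g w - b = c" by (auto simp: constant_on_def)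
        then have "(deriv ^^ k) g constant_on ball z 1"
          unfolding constant_on_def by (intro exI[of _ "c + b"]) (auto simp: algebra_simps)
        then show False using entire_constant_on_ball[OF holg _ zero_less_one] nc by blast
      qed
    qed (use z in auto)
    obtain i :: nat where i: "cmod z + 1 < real i" using reals_Archimedean2[of "cmod z + 1"] by blast
    have "\<forall>\<^sub>F n in sequentially. 1 / 2 * exp (4 * N * (real i + 2)) < E (r n)"
      using eventually_subseq[OF r filterlim_at_top_dense[THEN iffD1, OF E, THEN spec]] .
    then have "\<forall>\<^sub>F n in sequentially. False"
      using ev domH[of "real i"] eventually_subseq[OF r growth[of i]]
    proof eventually_elim
      case (elim n)
      then obtain w where w: "w \<in> ball z 1" "(deriv ^^ k) (H n) w = b" by auto
      have wi: "w \<in> ball 0 (real i)"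
        using w i norm_triangle_ineq[of z "w - z"] by (simp add: dist_norm norm_minus_commute)
      then have "E (r n) \<le> cmod (H n w)"
        using share[of w "r n"] w(2) elim(3) by (simp add: H_def)
      also have "\<dots> \<le> 1 / 2 * exp (4 * N * (cmod w + 2))"
        using elim(4) wi by (simp add: H_def)
      also have "\<dots> \<le> 1 / 2 * exp (4 * N * (real i + 2))"
        using wi N by simp
      finally show False using elim(1) by simp
    qed
    then show False by simp
  qed
  show False
    by (rule entire_limit_contradiction[OF g _ _ ggrowth k A g0 g1 z1 z2 b omit]) (use N in auto)
qed

section \<open>Choice of centre and scale\<close>

text \<open>The set would fail to be closed only at zeros of \<open>f\<close>, and those have neighbourhoods that do not
  meet it.\<close>

lemma compact_large_gradient_set:
  assumes f: "f holomorphic_on D" and D: "open D" and sub: "cball z0 R \<subseteq> D"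
    and near: "\<And>z. z \<in> D \<Longrightarrow> f z = 0 \<Longrightarrow> \<forall>\<^sub>F w in nhds z. f w \<noteq> 0 \<longrightarrow> cmod (deriv f w) ^ k < N * cmod (f w) ^ m"
  shows "compact {z \<in> cball z0 R. f z \<noteq> 0 \<and> cmod (deriv f z) ^ k \<ge> N * cmod (f z) ^ m}" (is "compact ?X")
proof -
  have "open (- ?X)"
  proof (subst open_subopen, intro ballI)
    fix z assume z: "z \<in> - ?X"
    have "\<forall>\<^sub>F w in nhds z. w \<in> - ?X"
    proof (cases "z \<in> cball z0 R")
      case False
      then have "\<forall>\<^sub>F w in nhds z. w \<in> - cball z0 R" by (intro eventually_nhds_in_open) auto
      then show ?thesis by (rule eventually_mono) auto
    next
      case True
      then have zD: "z \<in> D" using sub by auto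
      show ?thesis
      proof (cases "f z = 0")
        case True
        from near[OF zD this] show ?thesis by (rule eventually_mono) auto
      next
        case False
        define Y where "Y w = N * cmod (f w) ^ m - cmod (deriv f w) ^ k" for w
        have "isCont f z" "isCont (deriv f) z"
          using f holomorphic_deriv[OF f D] D zD
          by (auto dest!: holomorphic_on_imp_continuous_on simp: continuous_on_eq_continuous_at)
        then have "isCont Y z" unfolding Y_def by (intro continuous_intros)
        moreover have "0 < Y z" using z True False by (auto simp: Y_def)
        ultimately have "\<forall>\<^sub>F w in nhds z. 0 < Y w"
          by (auto simp: isCont_def tendsto_at_iff_tendsto_nhds intro: order_tendstoD(1))
        then show ?thesis by (rule eventually_mono) (auto simp: Y_def)
      qed
    qed
    then show "\<exists>T. open T \<and> z \<in> T \<and> T \<subseteq> - ?X" by (auto simp: eventually_nhds)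
  qed
  then have "closed ?X" by (simp add: closed_def)
  then have "compact (cball z0 R \<inter> ?X)" by (intro compact_Int_closed compact_cball)
  moreover have "cball z0 R \<inter> ?X = ?X" by auto
  ultimately show ?thesis by simp
qed

text \<open>If \<open>f\<close> comes down to the level \<open>L\<close> somewhere in the small ball, then the growth lemma bounds it on
  the whole small ball. The radius \<open>R / 8\<close> leaves room for the balls used there.\<close>

lemma dichotomy_from_gradient_bound:
  fixes f :: "complex \<Rightarrow> complex"
  assumes f: "f holomorphic_on D" and D: "open D" and sub: "cball z0 R \<subseteq> D" and R: "R > 0" and L: "L > 0" and M: "M \<ge> 0"
    and grad: "\<And>w. w \<in> ball z0 (R / 2) \<Longrightarrow> cmod (f w) = L \<Longrightarrow> cmod (deriv f w) \<le> M * L"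
  shows "(\<forall>w\<in>ball z0 (R / 8). cmod (f w) \<le> L * exp (M * R)) \<or> (\<forall>w\<in>ball z0 (R / 8). cmod (f w) > L)"
proof (rule disjCI)
  assume "\<not> (\<forall>w\<in>ball z0 (R / 8). cmod (f w) > L)"
  then obtain p where p: "p \<in> ball z0 (R / 8)" "cmod (f p) \<le> L" by auto
  show "\<forall>w\<in>ball z0 (R / 8). cmod (f w) \<le> L * exp (M * R)"
  proof
    fix w assume w: "w \<in> ball z0 (R / 8)"
    have pw: "cmod (p - w) < R / 4"
      using p(1) w dist_triangle[of p w z0] by (simp add: dist_norm[symmetric] dist_commute)
    have inb: "v \<in> ball z0 (R / 2)" if "v \<in> cball w (cmod (p - w))" for v
    proof -
      have "dist z0 v \<le> dist z0 w + dist w v" by (rule dist_triangle)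
      moreover have "dist w v \<le> cmod (p - w)" "dist z0 w < R / 8" using that w by auto
      ultimately show ?thesis using pw R by simp
    qed
    have "cball w (cmod (p - w)) \<subseteq> D"
    proof
      fix v assume "v \<in> cball w (cmod (p - w))"
      from inb[OF this] have "v \<in> cball z0 R" using R by simp
      then show "v \<in> D" using sub by auto
    qed
    then have "cmod (f w) \<le> L * exp (2 * M * cmod (p - w))"
      by (intro growth_from_level_gradient[OF f D _ L M p(2)] grad inb)
    also have "2 * M * cmod (p - w) \<le> 2 * M * (R / 4)" using pw M by (intro mult_left_mono) auto
    also have "\<dots> \<le> M * R" using M R by simp
    finally show "cmod (f w) \<le> L * exp (M * R)" using L by simp
  qed
qed

text \<open>Call a point of \<open>cball z0 R\<close> steep for \<open>f\<close> if \<open>f\<close> does not vanish and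
  \<open>\<bar>f'\<bar>^k \<ge> N * \<bar>f\<bar>^(k-1)\<close> there, and let \<open>\<delta>\<close> be the distance to the boundary of the ball.
  This condition is invariant under \<open>f \<mapsto> f (z + \<rho> * w) / \<rho>^k\<close>.
  If \<open>\<delta>^k / \<bar>f\<bar>\<close> is bounded at steep points, uniformly for the family, then there are no steep points
  on a fixed low level set near \<open>z0\<close>, and the dichotomy follows.
  Otherwise let \<open>z n\<close> maximise \<open>\<delta>^k / \<bar>f n\<bar>\<close> over the steep points of \<open>f n\<close>, the maximum \<open>T n\<close>
  tending to infinity, and rescale at \<open>z n\<close> by \<open>\<rho> n = \<bar>f n (z n)\<bar> powr (1/k)\<close>. The rescaled
  functions live on discs of radius \<open>T n powr (1/k)\<close> and have modulus \<open>1\<close> at \<open>0\<close>. By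
  maximality they have no steep points of modulus \<open>1/2\<close> on any given disc from some index on.
  This is the situation just excluded.\<close>

lemma local_dichotomy:
  fixes \<F> :: "(complex \<Rightarrow> complex) set" and b :: complex and A \<epsilon> :: real
  assumes D: "open D" and z0: "z0 \<in> D" and k: "k > 0" and A: "A \<ge> 0" and b: "b \<noteq> 0" and eps: "\<epsilon> > 0"
    and hol: "\<And>f. f \<in> \<F> \<Longrightarrow> f holomorphic_on D"
    and mult: "\<And>f. f \<in> \<F> \<Longrightarrow> zeros_multiplicity_ge D f k"
    and zero: "\<And>f z. f \<in> \<F> \<Longrightarrow> z \<in> D \<Longrightarrow> f z = 0 \<Longrightarrow> cmod ((deriv ^^ k) f z) \<le> A"
    and share: "\<And>f z. f \<in> \<F> \<Longrightarrow> z \<in> D \<Longrightarrow> (deriv ^^ k) f z = b \<Longrightarrow> cmod (f z) \<ge> \<epsilon>"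
  obtains s B L where "s > 0" "L > 0" "ball z0 s \<subseteq> D"
    "\<And>f. f \<in> \<F> \<Longrightarrow> (\<forall>w\<in>ball z0 s. cmod (f w) \<le> B) \<or> (\<forall>w\<in>ball z0 s. cmod (f w) > L)"
proof -
  obtain R where R: "R > 0" "cball z0 R \<subseteq> D" using D z0 open_contains_cball by blast
  define N where "N = real k ^ k * (A + 1)"
  have N0: "N > 0" using k A by (simp add: N_def)
  define \<delta> where "\<delta> z = R - dist z0 z" for z
  define X where "X f = {z \<in> cball z0 R. f z \<noteq> 0 \<and> cmod (deriv f z) ^ k \<ge> N * cmod (f z) ^ (k - 1)}" for f
  have compX: "compact (X f)" if "f \<in> \<F>" for f
    unfolding X_def N_def
    by (rule compact_large_gradient_set[OF hol[OF that] D R(2)])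
       (rule derivative_small_near_zeros[OF hol[OF that] D mult[OF that] _ _ k zero[OF that]])
  show thesis
  proof (cases "\<exists>T. \<forall>f\<in>\<F>. \<forall>z\<in>X f. \<delta> z ^ k \<le> T * cmod (f z)")
    case True
    then obtain T0 where T0: "\<And>f z. f \<in> \<F> \<Longrightarrow> z \<in> X f \<Longrightarrow> \<delta> z ^ k \<le> T0 * cmod (f z)" by blast
    define T where "T = max T0 1"
    have T: "T > 0" "\<And>f z. f \<in> \<F> \<Longrightarrow> z \<in> X f \<Longrightarrow> \<delta> z ^ k \<le> T * cmod (f z)"
      by (simp add: T_def) (rule order_trans[OF T0], auto simp: T_def intro!: mult_right_mono)
    \<comment> \<open>Half of the least modulus that a steep point in \<open>ball z0 (R / 2)\<close> can have, since \<open>\<delta> \<ge> R / 2\<close> there.\<close>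
    define L where "L = (R / 2) ^ k / (2 * T)"
    define M where "M = max 1 (N * L ^ (k - 1)) / L"
    have L: "L > 0" using R T by (simp add: L_def)
    have M: "M \<ge> 0" using L by (simp add: M_def)
    have grad: "cmod (deriv f w) \<le> M * L" if f: "f \<in> \<F>" and w: "w \<in> ball z0 (R / 2)" "cmod (f w) = L" for f w
    proof -
      have "w \<notin> X f"
      proof
        assume "w \<in> X f"
        have "(R / 2) ^ k \<le> \<delta> w ^ k" using w R by (intro power_mono) (auto simp: \<delta>_def)
        also have "\<dots> \<le> T * L" using T(2)[OF f \<open>w \<in> X f\<close>] w by simp
        also have "\<dots> = (R / 2) ^ k / 2" using T by (simp add: L_def)
        finally show False using R by simp
      qed
      then have less: "cmod (deriv f w) ^ k < N * L ^ (k - 1)" using w L R by (auto simp: X_def)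
      have "cmod (deriv f w) \<le> max 1 (N * L ^ (k - 1))"
      proof (cases "cmod (deriv f w) \<le> 1")
        case False
        then have "cmod (deriv f w) \<le> cmod (deriv f w) ^ k" using k by (intro self_le_power) auto
        then show ?thesis using less by simp
      qed simp
      then show ?thesis using L by (simp add: M_def)
    qed
    show thesis
    proof (rule that[of "R / 8" L "L * exp (M * R)"])
      have "ball z0 (R / 8) \<subseteq> cball z0 R" using R by (auto simp: subset_iff)
      then show "ball z0 (R / 8) \<subseteq> D" using R by blast
      show "(\<forall>w\<in>ball z0 (R / 8). cmod (f w) \<le> L * exp (M * R)) \<or> (\<forall>w\<in>ball z0 (R / 8). cmod (f w) > L)"
        if "f \<in> \<F>" for f
        by (rule dichotomy_from_gradient_bound[OF hol[OF that] D R(2,1) L M grad[OF that]])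
    qed (use R L in simp_all)
  next
    case False
    have "\<exists>f z T. f \<in> \<F> \<and> z \<in> X f \<and> \<delta> z ^ k = T * cmod (f z) \<and> T > real n \<and> (\<forall>w\<in>X f. \<delta> w ^ k \<le> T * cmod (f w))" for n
    proof -
      obtain f w where f: "f \<in> \<F>" and w: "w \<in> X f" "\<delta> w ^ k > real n * cmod (f w)"
        using False by (meson not_le)
      have nz: "f v \<noteq> 0" if "v \<in> X f" for v using that by (simp add: X_def)
      have "X f \<subseteq> D" using R by (auto simp: X_def)
      then have "continuous_on (X f) f"
        using hol[OF f] holomorphic_on_imp_continuous_on continuous_on_subset by blast
      then have "continuous_on (X f) (\<lambda>v. \<delta> v ^ k / cmod (f v))"
        unfolding \<delta>_def by (intro continuous_intros) (use nz in auto)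
      then obtain z where z: "z \<in> X f" "\<And>v. v \<in> X f \<Longrightarrow> \<delta> v ^ k / cmod (f v) \<le> \<delta> z ^ k / cmod (f z)"
        using continuous_attains_sup[OF compX[OF f]] w by blast
      define T where "T = \<delta> z ^ k / cmod (f z)"
      have "real n < \<delta> w ^ k / cmod (f w)" using w nz[OF w(1)] by (simp add: less_divide_eq)
      also have "\<dots> \<le> T" using z(2)[OF w(1)] by (simp add: T_def)
      finally have "real n < T" .
      moreover have "\<delta> z ^ k = T * cmod (f z)" using nz[OF z(1)] by (simp add: T_def)
      moreover have "\<delta> v ^ k \<le> T * cmod (f v)" if "v \<in> X f" for v
        using z(2)[OF that] nz[OF that] by (simp add: T_def[symmetric] divide_le_eq)
      ultimately show ?thesis using f z(1) by blast
    qed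
    then have "\<forall>n. \<exists>x. fst x \<in> \<F> \<and> fst (snd x) \<in> X (fst x) \<and> \<delta> (fst (snd x)) ^ k = snd (snd x) * cmod (fst x (fst (snd x))) \<and>
       snd (snd x) > real n \<and> (\<forall>w\<in>X (fst x). \<delta> w ^ k \<le> snd (snd x) * cmod (fst x w))"
      by (auto simp: split_paired_Ex)
    from choice[OF this] obtain x where x: "\<And>n. fst (x n) \<in> \<F> \<and> fst (snd (x n)) \<in> X (fst (x n)) \<and>
      \<delta> (fst (snd (x n))) ^ k = snd (snd (x n)) * cmod (fst (x n) (fst (snd (x n)))) \<and>
       snd (snd (x n)) > real n \<and> (\<forall>w\<in>X (fst (x n)). \<delta> w ^ k \<le> snd (snd (x n)) * cmod (fst (x n) w))" by blast
    define f z T where "f n = fst (x n)" and "z n = fst (snd (x n))" and "T n = snd (snd (x n))" for n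
    have fF: "f n \<in> \<F>" and zX: "z n \<in> X (f n)" and eqT: "\<delta> (z n) ^ k = T n * cmod (f n (z n))" and Tn: "T n > real n"
      and maxT: "\<And>w. w \<in> X (f n) \<Longrightarrow> \<delta> w ^ k \<le> T n * cmod (f n w)" for n
      using x[of n] by (auto simp: f_def z_def T_def)
    have T0: "T n > 0" for n using Tn[of n] by (rule le_less_trans[rotated]) simp
    define \<rho> where "\<rho> n = root k (cmod (f n (z n)))" for n
    define t where "t n = root k (T n)" for n
    have nz: "f n (z n) \<noteq> 0" for n using zX[of n] by (simp add: X_def)
    have rho: "\<rho> n > 0" "\<rho> n ^ k = cmod (f n (z n))" for n
      using nz[of n] k by (auto simp: \<rho>_def)
    have t: "t n > 0" "t n ^ k = T n" for n using T0[of n] k by (auto simp: t_def)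
    have dz: "dist z0 (z n) \<le> R" for n using zX[of n] by (simp add: X_def)
    \<comment> \<open>So the disc of radius \<open>t n\<close> is mapped onto the ball around \<open>z n\<close> that touches the boundary of \<open>ball z0 R\<close>.\<close>
    have delta: "\<delta> (z n) = t n * \<rho> n" for n
    proof (rule power_eq_imp_eq_base)
      show "\<delta> (z n) ^ k = (t n * \<rho> n) ^ k" by (simp add: power_mult_distrib t rho eqT)
    qed (use dz[of n] t[of n] rho[of n] k in \<open>auto simp: \<delta>_def\<close>)
    define G where "G n w = inverse (of_real (\<rho> n ^ k)) * f n (of_real (\<rho> n) * w + z n)" for n w
    have dist_w: "dist z0 (of_real (\<rho> n) * w + z n) \<le> dist z0 (z n) + \<rho> n * cmod w" for n w
      using dist_triangle[of z0 "of_real (\<rho> n) * w + z n" "z n"] rho(1)[of n] by (simp add: dist_norm norm_mult)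
    have in_ball: "of_real (\<rho> n) * w + z n \<in> ball z0 R" if "w \<in> ball 0 (t n)" for n w
    proof -
      have "\<rho> n * cmod w < \<rho> n * t n" using that rho(1)[of n] by (intro mult_strict_left_mono) auto
      then show ?thesis using dist_w[of n w] delta[of n] by (simp add: \<delta>_def mult.commute)
    qed
    have holf: "f n holomorphic_on ball z0 R" for n
      using R by (intro holomorphic_on_subset[OF hol[OF fF]]) auto
    have inD: "of_real (\<rho> n) * w + z n \<in> D" if "w \<in> ball 0 (t n)" for n w
      using in_ball[OF that] R by auto
    have holc: "(\<lambda>w. f n (of_real (\<rho> n) * w + z n)) holomorphic_on ball 0 (t n)" for n
      by (rule holomorphic_on_compose_gen[OF _ holf, unfolded o_def])
         (use in_ball in \<open>auto intro!: holomorphic_intros simp del: mem_ball\<close>)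
    have holG: "G n holomorphic_on ball 0 (t n)" for n
      unfolding G_def by (intro holomorphic_intros holc)
    have dG: "(deriv ^^ j) (G n) w = inverse (of_real (\<rho> n ^ k)) * (of_real (\<rho> n) ^ j * (deriv ^^ j) (f n) (of_real (\<rho> n) * w + z n))"
      if w: "w \<in> ball 0 (t n)" for n j w
    proof -
      have "(deriv ^^ j) (G n) w = inverse (of_real (\<rho> n ^ k)) * (deriv ^^ j) (\<lambda>w. f n (of_real (\<rho> n) * w + z n)) w"
        unfolding G_def by (rule higher_deriv_cmult[OF holc w open_ball])
      also have "(deriv ^^ j) (\<lambda>w. f n (of_real (\<rho> n) * w + z n)) w = of_real (\<rho> n) ^ j * (deriv ^^ j) (f n) (of_real (\<rho> n) * w + z n)"
        by (rule higher_deriv_compose_linear'[OF holf open_ball open_ball w]) (rule in_ball)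
      finally show ?thesis .
    qed
    have dGk: "(deriv ^^ k) (G n) w = (deriv ^^ k) (f n) (of_real (\<rho> n) * w + z n)" if "w \<in> ball 0 (t n)" for n w
      using dG[OF that, of k] rho(1)[of n] by simp
    have normG: "cmod (G n w) = cmod (f n (of_real (\<rho> n) * w + z n)) / \<rho> n ^ k" for n w
      using rho(1)[of n] by (simp add: G_def norm_mult norm_inverse norm_power divide_inverse mult.commute)
    have dG1: "cmod (deriv (G n) w) ^ k = cmod (deriv (f n) (of_real (\<rho> n) * w + z n)) ^ k / (\<rho> n ^ k) ^ (k - 1)"
      if w: "w \<in> ball 0 (t n)" for n w
    proof -
      have "(\<rho> n / \<rho> n ^ k) ^ k = \<rho> n ^ k / (\<rho> n ^ k) ^ Suc (k - 1)"
        using k by (simp add: power_divide)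
      also have "\<dots> = 1 / (\<rho> n ^ k) ^ (k - 1)" using rho(1)[of n] by simp
      finally have eq: "(\<rho> n / \<rho> n ^ k) ^ k = 1 / (\<rho> n ^ k) ^ (k - 1)" .
      have "cmod (deriv (G n) w) = \<rho> n / \<rho> n ^ k * cmod (deriv (f n) (of_real (\<rho> n) * w + z n))"
        using dG[OF w, of 1] rho(1)[of n] by (simp add: norm_mult norm_inverse norm_power divide_inverse)
      then have "cmod (deriv (G n) w) ^ k = (\<rho> n / \<rho> n ^ k) ^ k * cmod (deriv (f n) (of_real (\<rho> n) * w + z n)) ^ k"
        by (simp only: power_mult_distrib)
      then show ?thesis unfolding eq by simp
    qed
    \<comment> \<open>Scale invariance of steepness.\<close>
    have transfer: "of_real (\<rho> n) * w + z n \<in> X (f n) \<longleftrightarrow> G n w \<noteq> 0 \<and> cmod (deriv (G n) w) ^ k \<ge> N * cmod (G n w) ^ (k - 1)"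
      if w: "w \<in> ball 0 (t n)" for n w
    proof -
      have "cmod (deriv (G n) w) ^ k \<ge> N * cmod (G n w) ^ (k - 1) \<longleftrightarrow>
        cmod (deriv (f n) (of_real (\<rho> n) * w + z n)) ^ k \<ge> N * cmod (f n (of_real (\<rho> n) * w + z n)) ^ (k - 1)"
        unfolding dG1[OF w] normG power_divide using rho(1)[of n] by (simp add: divide_le_cancel)
      moreover have "G n w \<noteq> 0 \<longleftrightarrow> f n (of_real (\<rho> n) * w + z n) \<noteq> 0"
        using rho(1)[of n] by (simp add: G_def)
      ultimately show ?thesis using in_ball[OF w] by (simp add: X_def less_imp_le)
    qed
    have G0: "cmod (G n 0) = 1" for n using rho(2)[of n] nz[of n] by (simp add: normG)
    have t_inf: "filterlim t at_top sequentially"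
    proof -
      have "filterlim T at_top sequentially"
        by (rule filterlim_at_top_mono[OF filterlim_real_sequentially]) (use Tn in \<open>auto simp: less_imp_le\<close>)
      then have ev: "\<forall>\<^sub>F n in sequentially. \<bar>Z\<bar> ^ k \<le> T n" for Z
        by (simp add: filterlim_at_top)
      show ?thesis
        unfolding filterlim_at_top
      proof
        fix Z
        show "\<forall>\<^sub>F n in sequentially. Z \<le> t n"
          using ev[of Z]
        proof eventually_elim
          case (elim n)
          have "\<not> t n < \<bar>Z\<bar>"
            using power_strict_mono[of "t n" "\<bar>Z\<bar>" k] t[of n] k elim by auto
          then show ?case by simp
        qed
      qed
    qed
    have E_inf: "filterlim (\<lambda>n. \<epsilon> / R ^ k * T n) at_top sequentially"
    proof -
      have "filterlim T at_top sequentially"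
        by (rule filterlim_at_top_mono[OF filterlim_real_sequentially]) (use Tn in \<open>auto simp: less_imp_le\<close>)
      then show ?thesis using eps R by (intro filterlim_tendsto_pos_mult_at_top[OF tendsto_const]) auto
    qed
    \<comment> \<open>By maximality, \<open>\<delta>^k\<close> at a steep point of modulus \<open>1/2\<close> is at most half of its value at \<open>z n\<close>. But within rescaled distance \<open>K\<close> of \<open>z n\<close>, \<open>\<delta>\<close> is at least \<open>1 - K / t n\<close> times its value there.\<close>
    have level: "\<forall>\<^sub>F n in sequentially. \<forall>w\<in>ball 0 K. cmod (G n w) = 1 / 2 \<longrightarrow> cmod (deriv (G n) w) ^ k \<le> N" for K
    proof -
      have "(\<lambda>n. (1 - K / t n) ^ k) \<longlonglongrightarrow> (1 - 0) ^ k"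
        by (intro tendsto_intros real_tendsto_divide_at_top[OF tendsto_const t_inf])
      then have "\<forall>\<^sub>F n in sequentially. 1 / 2 < (1 - K / t n) ^ k"
        by (rule order_tendstoD(1)) simp
      moreover have "\<forall>\<^sub>F n in sequentially. K < t n" using t_inf by (simp add: filterlim_at_top_dense)
      ultimately show ?thesis
      proof eventually_elim
        case (elim n)
        show ?case
        proof (intro ballI impI, rule ccontr)
          fix w assume w: "w \<in> ball 0 K" and half: "cmod (G n w) = 1 / 2" and not_le: "\<not> cmod (deriv (G n) w) ^ k \<le> N"
          define v where "v = of_real (\<rho> n) * w + z n"
          have wt: "w \<in> ball 0 (t n)" using w elim by simp
          have "N * cmod (G n w) ^ (k - 1) \<le> N * 1"
            using half N0 by (intro mult_left_mono power_le_one) auto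
          then have "v \<in> X (f n)" using transfer[OF wt] half not_le by (auto simp: v_def)
          then have "\<delta> v ^ k \<le> T n * cmod (f n v)" by (rule maxT)
          also have "cmod (f n v) = \<rho> n ^ k / 2" using normG[of n w] half rho(1)[of n] by (simp add: v_def field_simps)
          also have "T n * (\<rho> n ^ k / 2) = (t n * \<rho> n) ^ k / 2" by (simp add: power_mult_distrib t)
          finally have up: "\<delta> v ^ k \<le> (t n * \<rho> n) ^ k / 2" .
          have "\<rho> n * cmod w \<le> \<rho> n * K" using w rho(1)[of n] by (intro mult_left_mono) auto
          then have "t n * \<rho> n - \<rho> n * K \<le> \<delta> v"
            using dist_w[of n w] delta[of n] by (simp add: \<delta>_def v_def)
          moreover have "t n * \<rho> n - \<rho> n * K = t n * \<rho> n * (1 - K / t n)"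
            using t(1)[of n] by (simp add: field_simps)
          moreover have "0 \<le> t n * \<rho> n * (1 - K / t n)"
            using t(1)[of n] rho(1)[of n] elim by (intro mult_nonneg_nonneg) (auto simp: divide_le_eq)
          ultimately have "(t n * \<rho> n * (1 - K / t n)) ^ k \<le> \<delta> v ^ k" by (intro power_mono) auto
          then have "(t n * \<rho> n) ^ k * (1 - K / t n) ^ k \<le> (t n * \<rho> n) ^ k * (1 / 2)"
            using up by (simp add: power_mult_distrib)
          moreover have "(t n * \<rho> n) ^ k > 0" using t(1)[of n] rho(1)[of n] by simp
          ultimately have "(1 - K / t n) ^ k \<le> 1 / 2" by (simp only: mult_le_cancel_left_pos)
          then show False using elim by simp
        qed
      qed
    qed
    have False
    proof (rule rescaled_sequence_contradiction[OF t_inf E_inf k A b holG])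
      fix n w j assume w: "w \<in> ball 0 (t n)" and "G n w = 0" and j: "j < k"
      then have "f n (of_real (\<rho> n) * w + z n) = 0" using rho(1)[of n] by (simp add: G_def)
      then show "(deriv ^^ j) (G n) w = 0"
        using multiple_zero_higher_deriv[OF hol[OF fF] D mult[OF fF] inD[OF w] _ j] by (simp add: dG[OF w])
    next
      fix n w assume w: "w \<in> ball 0 (t n)" and "G n w = 0"
      then have "f n (of_real (\<rho> n) * w + z n) = 0" using rho(1)[of n] by (simp add: G_def)
      then show "cmod ((deriv ^^ k) (G n) w) \<le> A"
        using zero[OF fF inD[OF w]] by (simp add: dGk[OF w])
    next
      fix n w assume w: "w \<in> ball 0 (t n)" and "(deriv ^^ k) (G n) w = b"
      then have ge: "cmod (f n (of_real (\<rho> n) * w + z n)) \<ge> \<epsilon>" by (intro share[OF fF inD[OF w]]) (simp add: dGk[OF w])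
      have "T n * \<rho> n ^ k = \<delta> (z n) ^ k" using delta[of n] by (simp add: power_mult_distrib t)
      also have "\<dots> \<le> R ^ k" using dz[of n] by (intro power_mono) (auto simp: \<delta>_def)
      finally have "T n / R ^ k \<le> 1 / \<rho> n ^ k" using R rho(1)[of n] by (simp add: field_simps)
      then have "\<epsilon> * (T n / R ^ k) \<le> \<epsilon> * (1 / \<rho> n ^ k)" using eps by (intro mult_left_mono) auto
      also have "\<dots> \<le> cmod (G n w)" unfolding normG using ge rho(1)[of n] by (simp add: divide_right_mono)
      finally show "\<epsilon> / R ^ k * T n \<le> cmod (G n w)" by simp
    next
      fix n
      have "0 \<in> ball (0::complex) (t n)" using t(1)[of n] by simp
      from transfer[OF this] zX[of n] G0[of n] show "real k ^ k * (A + 1) \<le> cmod (deriv (G n) 0) ^ k"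
        by (simp add: N_def)
    qed (use G0 level in \<open>auto simp: N_def\<close>)
    then show thesis ..
  qed
qed

section \<open>From local convergence to normality\<close>

definition tends_to_infinity_on :: "complex set \<Rightarrow> (nat \<Rightarrow> complex \<Rightarrow> complex) \<Rightarrow> bool" where
  "tends_to_infinity_on S F \<longleftrightarrow> (\<forall>C. \<forall>\<^sub>F n in sequentially. \<forall>z\<in>S. cmod (F n z) \<ge> C)"

lemma tends_to_infinity_on_subseq:
  assumes "tends_to_infinity_on S F" "strict_mono (r :: nat \<Rightarrow> nat)"
  shows "tends_to_infinity_on S (F \<circ> r)"
  unfolding tends_to_infinity_on_def o_def
proof
  fix C
  have "\<forall>\<^sub>F n in sequentially. \<forall>z\<in>S. cmod (F n z) \<ge> C"
    using assms(1) unfolding tends_to_infinity_on_def by blast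
  from eventually_subseq[OF assms(2) this]
  show "\<forall>\<^sub>F n in sequentially. \<forall>z\<in>S. cmod (F (r n) z) \<ge> C" .
qed

lemma tends_to_infinity_on_tail:
  assumes "tends_to_infinity_on S (F \<circ> (+) m)"
  shows "tends_to_infinity_on S F"
  unfolding tends_to_infinity_on_def
proof
  fix C
  have "\<forall>\<^sub>F n in sequentially. \<forall>z\<in>S. cmod (F (n + m) z) \<ge> C"
    using assms unfolding tends_to_infinity_on_def by (simp add: add.commute)
  then show "\<forall>\<^sub>F n in sequentially. \<forall>z\<in>S. cmod (F n z) \<ge> C"
    by (rule eventually_sequentially_seg[THEN iffD1])
qed

text \<open>The two forms that uniform convergence of holomorphic functions in the spherical metric takes on
  small balls.\<close>

definition converges_or_diverges_uniformly_on :: "complex set \<Rightarrow> (nat \<Rightarrow> complex \<Rightarrow> complex) \<Rightarrow> bool" where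
  "converges_or_diverges_uniformly_on S F \<longleftrightarrow>
     (\<exists>g. g holomorphic_on S \<and> uniform_limit S F g sequentially) \<or> tends_to_infinity_on S F"

lemma converges_or_diverges_uniformly_on_subseq:
  assumes "converges_or_diverges_uniformly_on S F" "strict_mono (r :: nat \<Rightarrow> nat)"
  shows "converges_or_diverges_uniformly_on S (F \<circ> r)"
  using assms(1) unfolding converges_or_diverges_uniformly_on_def
proof
  assume "\<exists>g. g holomorphic_on S \<and> uniform_limit S F g sequentially"
  then show "(\<exists>g. g holomorphic_on S \<and> uniform_limit S (F \<circ> r) g sequentially) \<or> tends_to_infinity_on S (F \<circ> r)"
    using uniform_limit_compose_subseq[OF _ assms(2)] by blast
qed (use tends_to_infinity_on_subseq[OF _ assms(2)] in blast)

lemma converges_or_diverges_uniformly_on_tail: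
  assumes "converges_or_diverges_uniformly_on S (F \<circ> (+) m)"
  shows "converges_or_diverges_uniformly_on S F"
  using assms unfolding converges_or_diverges_uniformly_on_def
proof
  assume "\<exists>g. g holomorphic_on S \<and> uniform_limit S (F \<circ> (+) m) g sequentially"
  then obtain g where "g holomorphic_on S" "uniform_limit S (F \<circ> (+) m) g sequentially" by blast
  then show "(\<exists>g. g holomorphic_on S \<and> uniform_limit S F g sequentially) \<or> tends_to_infinity_on S F"
    using uniform_limit_tail by blast
qed (use tends_to_infinity_on_tail in blast)

lemma Montel_ball_subsequence:
  fixes F :: "nat \<Rightarrow> complex \<Rightarrow> complex"
  assumes s: "0 < s'" "s' < s" and hol: "\<And>n. F n holomorphic_on ball z0 s"
    and bd: "\<And>n w. w \<in> ball z0 s \<Longrightarrow> cmod (F n w) \<le> B"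
  obtains r where "strict_mono (r :: nat \<Rightarrow> nat)" "converges_or_diverges_uniformly_on (ball z0 s') (F \<circ> r)"
proof -
  obtain r g where rg: "strict_mono r" "g holomorphic_on ball z0 s"
    "\<And>K. compact K \<Longrightarrow> K \<subseteq> ball z0 s \<Longrightarrow> uniform_limit K (F \<circ> r) g sequentially"
    by (rule Montel_eventually_bounded[where F = F, OF open_ball always_eventually[OF allI[OF hol]]
          always_eventually[OF allI[OF ballI[OF bd]]]]) (assumption, erule (1) that, blast)
  have "uniform_limit (cball z0 s') (F \<circ> r) g sequentially"
    using s by (intro rg(3)) auto
  then have "uniform_limit (ball z0 s') (F \<circ> r) g sequentially"
    by (rule uniform_limit_on_subset) auto
  moreover have "g holomorphic_on ball z0 s'" using s by (intro holomorphic_on_subset[OF rg(2)]) auto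
  ultimately have "converges_or_diverges_uniformly_on (ball z0 s') (F \<circ> r)" unfolding converges_or_diverges_uniformly_on_def by blast
  with rg(1) show thesis by (rule that)
qed

text \<open>Harnack's inequality for \<open>ln (\<bar>f\<bar> / L)\<close> in the ball of radius \<open>3 * s / 4\<close> around \<open>v\<close>. The point \<open>u\<close> is
  at distance less than \<open>s / 2\<close>, and \<open>(3/4 + 1/2) / (3/4 - 1/2) = 5\<close>.\<close>

lemma Harnack_modulus_comparison:
  assumes f: "f holomorphic_on ball z0 s" and L: "L > 0"
    and gt: "\<And>w. w \<in> ball z0 s \<Longrightarrow> cmod (f w) > L"
    and u: "u \<in> ball z0 (s / 4)" and v: "v \<in> ball z0 (s / 4)"
  shows "ln (cmod (f v) / L) \<le> 5 * ln (cmod (f u) / L)"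
proof -
  have s: "s > 0" using u zero_le_dist[of z0 u] by (simp del: zero_le_dist)
  have inb: "w \<in> ball z0 s" if "w \<in> ball v (3 * s / 4)" for w
    using that v dist_triangle[of z0 w v] by simp
  have uv: "cmod (u - v) < s / 2"
    using u v dist_triangle[of u v z0] by (simp add: dist_norm[symmetric] dist_commute)
  have ub: "u \<in> ball v (3 * s / 4)" using uv s by (simp add: dist_norm norm_minus_commute)
  have vb: "v \<in> ball v (3 * s / 4)" using s by simp
  have holv: "f holomorphic_on ball v (3 * s / 4)" using inb by (intro holomorphic_on_subset[OF f]) auto
  have gtv: "cmod (f w) > L" if "w \<in> ball v (3 * s / 4)" for w using gt[OF inb[OF that]] .
  obtain F where F: "F holomorphic_on ball v (3 * s / 4)"
    "\<And>w. w \<in> ball v (3 * s / 4) \<Longrightarrow> Re (F w) = ln (cmod (f w) / L)"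
    "\<And>w. w \<in> ball v (3 * s / 4) \<Longrightarrow> Re (F w) > 0"
    using nonvanishing_log_ball[OF holv L gtv] by metis
  have "Re (F v) * (s / 4) \<le> Re (F v) * (3 * s / 4 - cmod (u - v))"
    using uv F(3)[OF vb] by (intro mult_left_mono) auto
  also have "\<dots> \<le> Re (F u) * (3 * s / 4 + cmod (u - v))"
    by (rule Harnack_lower_bound[OF F(1,3) ub])
  also have "\<dots> \<le> Re (F u) * (5 * s / 4)"
    using uv F(3)[OF ub] by (intro mult_left_mono) auto
  finally have "(s / 4) * Re (F v) \<le> (s / 4) * (5 * Re (F u))" by (simp add: mult_ac)
  then have "Re (F v) \<le> 5 * Re (F u)" using s by (simp only: mult_le_cancel_left_pos)
  then show ?thesis using F(2) ub vb by simp
qed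

text \<open>If the values at the centre are bounded along some subsequence, then so are the functions on a
  smaller ball, by the first alternative or by Harnack's inequality, and Montel's theorem applies.
  Otherwise the values at the centre tend to infinity, the second alternative holds from some index
  on, and Harnack's inequality makes the divergence uniform.\<close>

lemma locally_convergent_subsequence:
  fixes F :: "nat \<Rightarrow> complex \<Rightarrow> complex"
  assumes s: "s > 0" and L: "L > 0" and hol: "\<And>n. F n holomorphic_on ball z0 s"
    and dich: "\<And>n. (\<forall>w\<in>ball z0 s. cmod (F n w) \<le> B) \<or> (\<forall>w\<in>ball z0 s. cmod (F n w) > L)"
  shows "\<exists>r. strict_mono (r :: nat \<Rightarrow> nat) \<and> converges_or_diverges_uniformly_on (ball z0 (s / 8)) (F \<circ> r)"
proof (cases "\<exists>M. \<not> (\<forall>\<^sub>F n in sequentially. cmod (F n z0) > M)")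
  case True
  then obtain M where "\<not> (\<forall>\<^sub>F n in sequentially. cmod (F n z0) > M)" by blast
  from not_eventually_sequentiallyD[OF this]
  obtain r :: "nat \<Rightarrow> nat" where r: "strict_mono r" "\<And>n. cmod (F (r n) z0) \<le> M" by (auto simp: not_less)
  define B' where "B' = max B (L * exp (5 * ln (max M L / L)))"
  have bd: "cmod (F (r n) w) \<le> B'" if w: "w \<in> ball z0 (s / 4)" for n w
    using dich[of "r n"]
  proof
    assume "\<forall>w\<in>ball z0 s. cmod (F (r n) w) \<le> B"
    moreover have "w \<in> ball z0 s" using w s by simp
    ultimately have "cmod (F (r n) w) \<le> B" by blast
    then show ?thesis by (simp add: B'_def)
  next
    assume gt: "\<forall>w\<in>ball z0 s. cmod (F (r n) w) > L"
    have z0: "z0 \<in> ball z0 (s / 4)" using s by simp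
    have "w \<in> ball z0 s" "z0 \<in> ball z0 s" using w s by auto
    then have pos: "cmod (F (r n) w) > L" "cmod (F (r n) z0) > L" using gt by blast+
    have "ln (cmod (F (r n) w) / L) \<le> 5 * ln (cmod (F (r n) z0) / L)"
      by (rule Harnack_modulus_comparison[OF hol L _ z0 w]) (use gt in blast)
    also have "\<dots> \<le> 5 * ln (max M L / L)"
    proof -
      have "cmod (F (r n) z0) / L \<le> max M L / L"
        using r(2)[of n] L by (intro divide_right_mono) auto
      moreover have "cmod (F (r n) z0) / L > 0" using pos L by (intro divide_pos_pos) auto
      ultimately show ?thesis by (simp add: ln_mono)
    qed
    finally have "exp (ln (cmod (F (r n) w) / L)) \<le> exp (5 * ln (max M L / L))" by simp
    moreover have "cmod (F (r n) w) / L > 0" using pos L by (intro divide_pos_pos) auto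
    ultimately have "cmod (F (r n) w) / L \<le> exp (5 * ln (max M L / L))" by simp
    then have "cmod (F (r n) w) \<le> L * exp (5 * ln (max M L / L))"
      using L by (simp add: divide_le_eq mult.commute)
    then show ?thesis by (simp add: B'_def)
  qed
  have "(F \<circ> r) n holomorphic_on ball z0 (s / 4)" for n
    using s hol[of "r n"] by (auto intro: holomorphic_on_subset)
  moreover have "0 < s / 8" "s / 8 < s / 4" using s by auto
  ultimately obtain r' where r': "strict_mono (r' :: nat \<Rightarrow> nat)" "converges_or_diverges_uniformly_on (ball z0 (s / 8)) (F \<circ> r \<circ> r')"
    using Montel_ball_subsequence[of "s / 8" "s / 4" "F \<circ> r" z0 B'] bd by auto
  then show ?thesis using strict_mono_o[OF r(1) r'(1)] by (auto simp: o_assoc)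
next
  case False
  have z0: "z0 \<in> ball z0 (s / 4)" using s by simp
  have "tends_to_infinity_on (ball z0 (s / 8)) F"
    unfolding tends_to_infinity_on_def
  proof
    fix C :: real
    define C' where "C' = max C L"
    have C': "C' > 0" using L by (simp add: C'_def)
    have "\<forall>\<^sub>F n in sequentially. cmod (F n z0) > max B (L * exp (5 * ln (C' / L)))"
      using False by blast
    then show "\<forall>\<^sub>F n in sequentially. \<forall>w\<in>ball z0 (s / 8). cmod (F n w) \<ge> C"
    proof eventually_elim
      case (elim n)
      have "\<not> cmod (F n z0) \<le> B" "z0 \<in> ball z0 s" using elim s by auto
      then have "\<not> (\<forall>w\<in>ball z0 s. cmod (F n w) \<le> B)" by blast
      then have gt: "\<And>w. w \<in> ball z0 s \<Longrightarrow> cmod (F n w) > L" using dich[of n] by blast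
      show ?case
      proof
        fix w assume "w \<in> ball z0 (s / 8)"
        then have w: "w \<in> ball z0 (s / 4)" using s by simp
        have "w \<in> ball z0 s" "z0 \<in> ball z0 s" using w s by auto
        then have pos: "cmod (F n w) > L" "cmod (F n z0) > L" using gt by blast+
        have "L * exp (5 * ln (C' / L)) < cmod (F n z0)" using elim by simp
        then have "exp (5 * ln (C' / L)) < cmod (F n z0) / L"
          using L by (simp add: less_divide_eq mult.commute)
        also have "\<dots> = exp (ln (cmod (F n z0) / L))" using pos L less_trans[OF L pos(2)] by simp
        finally have "5 * ln (C' / L) < ln (cmod (F n z0) / L)" by simp
        also have "\<dots> \<le> 5 * ln (cmod (F n w) / L)"
          by (rule Harnack_modulus_comparison[OF hol L gt w z0])
        finally have "exp (ln (C' / L)) < exp (ln (cmod (F n w) / L))" by simp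
        then have "C' / L < cmod (F n w) / L" using C' L less_trans[OF L pos(1)] by simp
        then show "cmod (F n w) \<ge> C" using L by (simp add: divide_less_cancel C'_def)
      qed
    qed
  qed
  then show ?thesis by (intro exI[of _ id]) (simp add: converges_or_diverges_uniformly_on_def strict_mono_def)
qed

lemma chordal_dist_le: "chordal_dist (Some z) (Some w) \<le> 2 * cmod (z - w)"
proof -
  have "1 * 1 \<le> sqrt (1 + (cmod z)\<^sup>2) * sqrt (1 + (cmod w)\<^sup>2)"
    by (intro mult_mono) auto
  then have "2 * cmod (z - w) / (sqrt (1 + (cmod z)\<^sup>2) * sqrt (1 + (cmod w)\<^sup>2)) \<le> 2 * cmod (z - w) / 1"
    by (intro divide_left_mono) auto
  then show ?thesis by simp
qed

lemma chordal_dist_infinity_less: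
  assumes "e > 0" "cmod z \<ge> 2 / e"
  shows "chordal_dist (Some z) None < e"
proof -
  have "2 / e < sqrt (1 + (2 / e)\<^sup>2)" by (rule real_less_rsqrt) simp
  also have "\<dots> \<le> sqrt (1 + (cmod z)\<^sup>2)" using assms by (intro real_sqrt_le_mono add_left_mono power_mono) auto
  finally have "2 < sqrt (1 + (cmod z)\<^sup>2) * e" using assms(1) by (simp add: divide_less_eq)
  moreover have "sqrt (1 + (cmod z)\<^sup>2) > 0" by (simp add: add_pos_nonneg)
  ultimately show ?thesis by (simp add: divide_less_eq mult.commute)
qed

text \<open>Countably many of the given balls cover \<open>D\<close>, and a diagonal subsequence converges on each of them,
  to a holomorphic function or to infinity. The unions of the balls of the two kinds are open and
  disjoint, so that by connectedness only one kind occurs.\<close>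

lemma normal_family_if_locally_convergent_subsequences:
  fixes \<F> :: "(complex \<Rightarrow> complex) set"
  assumes D: "open D" "connected D" "D \<noteq> {}" and hol: "\<And>f. f \<in> \<F> \<Longrightarrow> f holomorphic_on D"
    and loc: "\<And>z. z \<in> D \<Longrightarrow> \<exists>s>0. ball z s \<subseteq> D \<and> (\<forall>F. (\<forall>n. F n \<in> \<F>) \<longrightarrow>
        (\<exists>r. strict_mono (r :: nat \<Rightarrow> nat) \<and> converges_or_diverges_uniformly_on (ball z s) (F \<circ> r)))"
  shows "normal_family D \<F>"
  unfolding normal_family_def
proof (intro allI impI)
  fix f :: "nat \<Rightarrow> complex \<Rightarrow> complex" assume f: "\<forall>n. f n \<in> \<F>"
  obtain s where s: "\<And>z. z \<in> D \<Longrightarrow> s z > 0" "\<And>z. z \<in> D \<Longrightarrow> ball z (s z) \<subseteq> D"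
    "\<And>z F. z \<in> D \<Longrightarrow> \<forall>n. F n \<in> \<F> \<Longrightarrow> \<exists>r. strict_mono (r :: nat \<Rightarrow> nat) \<and> converges_or_diverges_uniformly_on (ball z (s z)) (F \<circ> r)"
    using loc by metis
  define \<C> where "\<C> = (\<lambda>z. ball z (s z)) ` D"
  have "\<And>S. S \<in> \<C> \<Longrightarrow> open S" by (auto simp: \<C>_def)
  from Lindelof[OF this] obtain \<C>' where C': "\<C>' \<subseteq> \<C>" "countable \<C>'" "\<Union>\<C>' = \<Union>\<C>" by metis
  have "\<Union>\<C> = D" using s(1,2) by (force simp: \<C>_def)
  then have "\<C>' \<noteq> {}" using D C' by auto
  define C where "C = from_nat_into \<C>'"
  have rangeC: "range C = \<C>'" unfolding C_def by (rule range_from_nat_into[OF \<open>\<C>' \<noteq> {}\<close> C'(2)])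
  have CD: "(\<Union>i. C i) = D" using rangeC C' \<open>\<Union>\<C> = D\<close> by simp
  have Cball: "\<exists>z\<in>D. C i = ball z (s z)" for i using rangeC C'(1) unfolding \<C>_def by blast
  have Copen: "open (C i)" for i using Cball[of i] by auto
  obtain \<sigma> where \<sigma>: "strict_mono \<sigma>" "\<And>i. converges_or_diverges_uniformly_on (C i) (f \<circ> \<sigma>)"
  proof (rule diagonal_subsequence[of "\<lambda>i \<sigma>. converges_or_diverges_uniformly_on (C i) (f \<circ> \<sigma>)"])
    show "\<exists>r. strict_mono (r :: nat \<Rightarrow> nat) \<and> converges_or_diverges_uniformly_on (C i) (f \<circ> (t \<circ> r))" for i and t :: "nat \<Rightarrow> nat"
      using Cball[of i] s(3)[of _ "f \<circ> t"] f unfolding o_assoc by auto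
    show "converges_or_diverges_uniformly_on (C i) (f \<circ> (t \<circ> r))" if "strict_mono r" "converges_or_diverges_uniformly_on (C i) (f \<circ> t)"
      for i and t r :: "nat \<Rightarrow> nat"
      unfolding o_assoc by (rule converges_or_diverges_uniformly_on_subseq[OF that(2,1)])
    show "converges_or_diverges_uniformly_on (C i) (f \<circ> t)" if "converges_or_diverges_uniformly_on (C i) (f \<circ> (t \<circ> (+) m))"
      for i and t :: "nat \<Rightarrow> nat" and m
      by (rule converges_or_diverges_uniformly_on_tail) (use that in \<open>simp add: o_assoc\<close>)
  qed (erule that, blast)
  define h where "h = f \<circ> \<sigma>"
  have sv: "sphere_value (f (\<sigma> n)) w = Some (h n w)" if "w \<in> D" for n w
    using not_is_pole_holomorphic[OF D(1) that hol] f by (simp add: sphere_value_def h_def)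
  define I where "I = {i. tends_to_infinity_on (C i) h}"
  define J where "J = {i. \<exists>g. g holomorphic_on C i \<and> uniform_limit (C i) h g sequentially}"
  have IJ: "i \<in> I \<or> i \<in> J" for i
    using \<sigma>(2)[of i] by (auto simp: I_def J_def converges_or_diverges_uniformly_on_def h_def)
  have disj: "z \<notin> C i \<or> z \<notin> C j" if "i \<in> I" "j \<in> J" for i j z
  proof (rule ccontr)
    assume "\<not> ?thesis"
    then have z: "z \<in> C i" "z \<in> C j" by auto
    from that(2) obtain g where "uniform_limit (C j) h g sequentially" by (auto simp: J_def)
    then have "(\<lambda>n. h n z) \<longlonglongrightarrow> g z" by (rule tendsto_uniform_limitI) (rule z)
    then have "(\<lambda>n. cmod (h n z)) \<longlonglongrightarrow> cmod (g z)" by (rule tendsto_norm)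
    then have "\<forall>\<^sub>F n in sequentially. cmod (h n z) < cmod (g z) + 1" by (rule order_tendstoD(2)) simp
    moreover have "\<forall>\<^sub>F n in sequentially. \<forall>w\<in>C i. cmod (h n w) \<ge> cmod (g z) + 1"
      using that(1) by (simp add: I_def tends_to_infinity_on_def)
    ultimately have "\<forall>\<^sub>F n in sequentially. False" by eventually_elim (use z in force)
    then show False by simp
  qed
  \<comment> \<open>Connectedness of \<open>D\<close> rules out finite and infinite limits on different parts of \<open>D\<close>.\<close>
  have "(\<Union>i\<in>I. C i) \<inter> D = {} \<or> (\<Union>j\<in>J. C j) \<inter> D = {}"
  proof (rule connectedD[OF D(2)])
    show "open (\<Union>i\<in>I. C i)" "open (\<Union>j\<in>J. C j)" using Copen by auto
    show "(\<Union>i\<in>I. C i) \<inter> (\<Union>j\<in>J. C j) \<inter> D = {}" using disj by blast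
    show "D \<subseteq> (\<Union>i\<in>I. C i) \<union> (\<Union>j\<in>J. C j)" using CD IJ by blast
  qed
  then have "(\<forall>z\<in>D. \<exists>i\<in>J. z \<in> C i) \<or> (\<forall>z\<in>D. \<exists>i\<in>I. z \<in> C i)" using CD IJ by blast
  then show "\<exists>\<sigma> G. strict_mono \<sigma> \<and> ((\<exists>g. g nicely_meromorphic_on D \<and> G = sphere_value g) \<or> G = (\<lambda>_. None)) \<and>
      spherically_locally_uniform_limit D (\<lambda>n. sphere_value (f (\<sigma> n))) G"
  proof
    assume fin: "\<forall>z\<in>D. \<exists>i\<in>J. z \<in> C i"
    define g where "g z = lim (\<lambda>n. h n z)" for z
    have limJ: "g holomorphic_on C i \<and> uniform_limit (C i) h g sequentially" if "i \<in> J" for i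
    proof -
      from that obtain g' where g': "g' holomorphic_on C i" "uniform_limit (C i) h g' sequentially" by (auto simp: J_def)
      have eq: "g' z = g z" if "z \<in> C i" for z
        unfolding g_def by (rule limI[symmetric]) (rule tendsto_uniform_limitI[OF g'(2) that])
      have "uniform_limit (C i) h g' sequentially \<longleftrightarrow> uniform_limit (C i) h g sequentially"
        using eq by (intro uniform_limit_cong') auto
      then show ?thesis using g' holomorphic_transform[OF g'(1) eq] by blast
    qed
    have "g holomorphic_on (\<Union>i\<in>J. C i)"
      using limJ Copen by (intro holomorphic_on_UN_open) auto
    then have holg: "g holomorphic_on D" by (rule holomorphic_on_subset) (use fin in blast)
    have "g nicely_meromorphic_on D"
      using holg D(1) by (intro analytic_on_imp_nicely_meromorphic_on) (simp add: analytic_on_open)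
    moreover have "spherically_locally_uniform_limit D (\<lambda>n. sphere_value (f (\<sigma> n))) (sphere_value g)"
      unfolding spherically_locally_uniform_limit_def
    proof
      fix z assume "z \<in> D"
      then obtain i where i: "i \<in> J" "z \<in> C i" using fin by blast
      obtain r where r: "r > 0" "ball z r \<subseteq> C i" using Copen i(2) openE by blast
      show "\<exists>r>0. \<forall>e>0. \<forall>\<^sub>F n in sequentially. \<forall>w\<in>ball z r \<inter> D. chordal_dist (sphere_value (f (\<sigma> n)) w) (sphere_value g w) < e"
      proof (intro exI conjI allI impI)
        fix e :: real assume "e > 0"
        then have "e / 2 > 0" by simp
        from uniform_limitD[OF conjunct2[OF limJ[OF i(1)]] this]
        show "\<forall>\<^sub>F n in sequentially. \<forall>w\<in>ball z r \<inter> D. chordal_dist (sphere_value (f (\<sigma> n)) w) (sphere_value g w) < e"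
        proof eventually_elim
          case (elim n)
          show ?case
          proof
            fix w assume w: "w \<in> ball z r \<inter> D"
            have "sphere_value g w = Some (g w)"
              using not_is_pole_holomorphic[OF D(1) _ holg] w by (simp add: sphere_value_def)
            moreover have "cmod (h n w - g w) < e / 2" using elim w r(2) by (auto simp: dist_norm)
            ultimately show "chordal_dist (sphere_value (f (\<sigma> n)) w) (sphere_value g w) < e"
              using chordal_dist_le[of "h n w" "g w"] sv[of w n] w by (simp del: chordal_dist.simps)
          qed
        qed
      qed (rule r(1))
    qed
    ultimately show ?thesis using \<sigma>(1) by blast
  next
    assume inf: "\<forall>z\<in>D. \<exists>i\<in>I. z \<in> C i"
    have "spherically_locally_uniform_limit D (\<lambda>n. sphere_value (f (\<sigma> n))) (\<lambda>_. None)"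
      unfolding spherically_locally_uniform_limit_def
    proof
      fix z assume "z \<in> D"
      then obtain i where i: "i \<in> I" "z \<in> C i" using inf by blast
      obtain r where r: "r > 0" "ball z r \<subseteq> C i" using Copen i(2) openE by blast
      show "\<exists>r>0. \<forall>e>0. \<forall>\<^sub>F n in sequentially. \<forall>w\<in>ball z r \<inter> D. chordal_dist (sphere_value (f (\<sigma> n)) w) None < e"
      proof (intro exI conjI allI impI)
        fix e :: real assume e: "e > 0"
        have "\<forall>\<^sub>F n in sequentially. \<forall>w\<in>C i. cmod (h n w) \<ge> 2 / e"
          using i(1) by (simp add: I_def tends_to_infinity_on_def)
        then show "\<forall>\<^sub>F n in sequentially. \<forall>w\<in>ball z r \<inter> D. chordal_dist (sphere_value (f (\<sigma> n)) w) None < e"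
        proof eventually_elim
          case (elim n)
          show ?case
          proof
            fix w assume w: "w \<in> ball z r \<inter> D"
            then have "cmod (h n w) \<ge> 2 / e" using elim r(2) by blast
            then show "chordal_dist (sphere_value (f (\<sigma> n)) w) None < e"
              using chordal_dist_infinity_less[OF e] sv[of w n] w by (simp del: chordal_dist.simps)
          qed
        qed
      qed (rule r(1))
    qed
    then show ?thesis using \<sigma>(1) by blast
  qed
qed

theorem theorem2p13:
  fixes D A B :: "complex set" and k :: nat and \<F> :: "(complex \<Rightarrow> complex) set"
    and b :: complex and \<epsilon> :: real
  assumes "open D" and "connected D" and "D \<noteq> {}"
    and "k > 0"
    and "\<And>f. f \<in> \<F> \<Longrightarrow> f holomorphic_on D"
    and "\<And>f. f \<in> \<F> \<Longrightarrow> zeros_multiplicity_ge D f k"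
    and "b \<noteq> 0"
    and "compact A"
    and "\<epsilon> > 0" and "B = {z. cmod z \<ge> \<epsilon>}"
    and "\<And>f. f \<in> \<F> \<Longrightarrow> partially_share D f ((deriv ^^ k) f) 0 A"
    and "\<And>f. f \<in> \<F> \<Longrightarrow> partially_share D ((deriv ^^ k) f) f b B"
  shows "normal_family D \<F>"
proof (rule normal_family_if_locally_convergent_subsequences[OF assms(1-3,5)])
  fix z assume z: "z \<in> D"
  obtain a where a: "a > 0" "\<And>x. x \<in> A \<Longrightarrow> cmod x \<le> a"
    using compact_imp_bounded[OF \<open>compact A\<close>] unfolding bounded_pos by blast
  obtain s M L where s: "s > 0" "L > 0" "ball z s \<subseteq> D"
    and dich: "\<And>f. f \<in> \<F> \<Longrightarrow> (\<forall>w\<in>ball z s. cmod (f w) \<le> M) \<or> (\<forall>w\<in>ball z s. cmod (f w) > L)"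
  proof (rule local_dichotomy[OF \<open>open D\<close> z \<open>k > 0\<close> less_imp_le[OF a(1)] \<open>b \<noteq> 0\<close> \<open>\<epsilon> > 0\<close> assms(5,6)])
    show "cmod ((deriv ^^ k) f w) \<le> a" if "f \<in> \<F>" "w \<in> D" "f w = 0" for f w
      using assms(11)[OF that(1)] that a(2) by (simp add: partially_share_def)
    show "\<epsilon> \<le> cmod (f w)" if "f \<in> \<F>" "w \<in> D" "(deriv ^^ k) f w = b" for f w
      using assms(12)[OF that(1)] that assms(10) by (simp add: partially_share_def)
  qed (assumption | (erule (2) that, blast))+
  have "\<exists>r. strict_mono (r :: nat \<Rightarrow> nat) \<and> converges_or_diverges_uniformly_on (ball z (s / 8)) (F \<circ> r)"
    if F: "\<forall>n. F n \<in> \<F>" for F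
  proof (rule locally_convergent_subsequence[OF s(1,2)])
    show "F n holomorphic_on ball z s" for n using F s(3) by (blast intro: holomorphic_on_subset assms(5))
    show "(\<forall>w\<in>ball z s. cmod (F n w) \<le> M) \<or> (\<forall>w\<in>ball z s. cmod (F n w) > L)" for n
      using F by (intro dich) blast
  qed
  moreover have "ball z (s / 8) \<subseteq> D" using s by (intro order_trans[OF _ s(3)] subset_ball) simp
  ultimately show "\<exists>s>0. ball z s \<subseteq> D \<and> (\<forall>F. (\<forall>n. F n \<in> \<F>) \<longrightarrow>
        (\<exists>r. strict_mono (r :: nat \<Rightarrow> nat) \<and> converges_or_diverges_uniformly_on (ball z s) (F \<circ> r)))"
    using s(1) by (intro exI[of _ "s / 8"]) auto
qed

end
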